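(* Let $n$ take values only in an infinite set of odd square-free integers greater than $1$, and let $r$ be real. Let $J(z)=\sum_{j=1}^{n-1}\left(\frac{j}{n}\right)z^j$ be the character polynomial of degree $n-1$ and define \[ V(z)=\sum_{\substack{0\le j\le n-1\\ \gcd(j,n)>1}} z^j. \] Then \[ \liminf_{n\to\infty}\frac{1}{F(J_r+V_r)}\ge\liminf_{n\to\infty}\frac{1}{F(J_r)}+\liminf_{n\to\infty}\frac{n}{2p_n^3}, \] where $p_n$ is the smallest prime factor of $n$.
   Context: For real $\alpha\ge1$ and $A\in\mathbb{C}[z]$, $\|A\|_\alpha=\left(\frac{1}{2\pi}\int_0^{2\pi}|A(e^{i\theta})|^\alpha d\theta\right)^{1/\alpha}$. The merit factor of $A$ is $F(A)=\frac{\|A\|_2^4}{\|A\|_4^4-\|A\|_2^4}$. For a polynomial $A$ of degree at most $n-1$ (viewed as of length $n$) and real $r$, the rotation is $A_r(z)=z^{-\lfloor nr\rfloor}A(z)\bmod (z^n-1)$. $\left(\frac{\cdot}{n}\right)$ denotes the Jacobi symbol. *)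

theory Defs
  imports "HOL-Analysis.Analysis" "HOL-Number_Theory.Number_Theory"
    "HOL-Computational_Algebra.Polynomial" "HOL-Library.Extended_Real" "HOL-Computational_Algebra.Squarefree"
begin

definition lnorm :: "real \<Rightarrow> complex poly \<Rightarrow> real" where
  "lnorm \<alpha> A = ((1 / (2*pi)) * integral {0..2*pi} (\<lambda>\<theta>. cmod (poly A (cis \<theta>)) powr \<alpha>)) powr (1/\<alpha>)"

definition merit_factor :: "complex poly \<Rightarrow> real" where
  "merit_factor A = (lnorm 2 A)^4 / ((lnorm 4 A)^4 - (lnorm 2 A)^4)"

text \<open>Rotation A_r(z) = z^(-floor(n r)) A(z) mod (z^n - 1), for A viewed as of length n:
  the coefficient of z^k (0 <= k < n) is a_((k + floor(n r)) mod n).\<close>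
definition rotation :: "nat \<Rightarrow> real \<Rightarrow> complex poly \<Rightarrow> complex poly" where
  "rotation n r A = (\<Sum>k<n. Polynomial.monom (Polynomial.coeff A (nat ((int k + \<lfloor>real n * r\<rfloor>) mod int n))) k)"

definition jacobi :: "int \<Rightarrow> nat \<Rightarrow> int" where
  "jacobi a n = (\<Prod>p\<in>#prime_factorization n. Legendre a (int p))"

definition char_poly :: "nat \<Rightarrow> complex poly" where
  "char_poly n = (\<Sum>j\<in>{1..n-1}. Polynomial.monom (of_int (jacobi (int j) n)) j)"

definition V_poly :: "nat \<Rightarrow> complex poly" where
  "V_poly n = (\<Sum>j\<in>{j. j \<le> n-1 \<and> gcd j n > 1}. Polynomial.monom 1 j)"

definition smallest_prime_factor :: "nat \<Rightarrow> nat" where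
  "smallest_prime_factor n = Min (prime_factors n)"

end

theory Submission
  imports Defs "HOL-Real_Asymp.Real_Asymp"
begin

text \<open>
  Write \<open>X = J\<^sub>r\<close>, \<open>Y = V\<^sub>r\<close>, \<open>p = p\<^sub>n\<close> and \<open>N = n / p\<close>. Both \<open>Y\<close> and \<open>X + Y\<close> have all
  coefficients equal to 1 on a residue class modulo \<open>p\<close>, and the part of a polynomial in a residue
  class has no larger \<open>L\<^sub>4\<close> norm; by Cauchy-Schwarz, \<open>N\<close> ones in arithmetic progression have
  fourth moment at least \<open>N\<^sup>3 / 2\<close>. This settles the case \<open>p < n powr 0.33\<close>, where
  \<open>1 / F(X + Y) \<ge> n / (2 p\<^sup>3) - 1\<close> tends to infinity.

  Otherwise \<open>Y\<close> has only about \<open>n powr 0.67\<close> nonzero coefficients. The values of \<open>X\<close> at the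
  \<open>n\<close>-th roots of unity are Gauss sums, so interpolation gives \<open>\<bar>X\<bar> = O(sqrt n * ln n)\<close> on the
  unit circle. In \<open>\<bar>X + Y\<bar>\<^sup>4 \<ge> \<bar>X\<bar>\<^sup>4 + \<bar>Y\<bar>\<^sup>4 - 4 \<bar>X\<bar>\<^sup>3 \<bar>Y\<bar> - 4 \<bar>X\<bar> \<bar>Y\<bar>\<^sup>3\<close> the mixed terms
  then contribute \<open>o(n\<^sup>2)\<close>.
\<close>

subsection \<open>Means over the unit circle\<close>

definition circle_mean :: "(complex \<Rightarrow> real) \<Rightarrow> real" where
  "circle_mean f = 1 / (2 * pi) * integral {0..2*pi} (\<lambda>\<theta>. f (cis \<theta>))"

lemma integrable_on_circle:
  fixes f :: "complex \<Rightarrow> 'a::euclidean_space"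
  assumes "continuous_on UNIV f"
  shows "(\<lambda>\<theta>. f (cis \<theta>)) integrable_on {0..2*pi}"
proof (rule integrable_continuous_real)
  have "continuous_on {0..2*pi} cis"
    by (intro continuous_intros)
  then show "continuous_on {0..2*pi} (\<lambda>\<theta>. f (cis \<theta>))"
    by (rule continuous_on_compose2[OF assms]) auto
qed

lemma circle_mean_mono:
  assumes "continuous_on UNIV f" "continuous_on UNIV g"
    and "\<And>z. cmod z = 1 \<Longrightarrow> f z \<le> g z"
  shows "circle_mean f \<le> circle_mean g"
  unfolding circle_mean_def
  by (intro mult_left_mono integral_le integrable_on_circle assms) auto

lemma circle_mean_add:
  assumes "continuous_on UNIV f" "continuous_on UNIV g"
  shows "circle_mean (\<lambda>z. f z + g z) = circle_mean f + circle_mean g"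
  unfolding circle_mean_def
  using integral_add[OF integrable_on_circle[OF assms(1)] integrable_on_circle[OF assms(2)]]
  by (simp add: algebra_simps add_divide_distrib)

lemma circle_mean_cmult: "circle_mean (\<lambda>z. c * f z) = c * circle_mean f"
  unfolding circle_mean_def by simp

lemma circle_mean_const: "circle_mean (\<lambda>z. c) = c"
  unfolding circle_mean_def by simp

lemma circle_mean_nonneg:
  assumes "continuous_on UNIV f" "\<And>z. cmod z = 1 \<Longrightarrow> 0 \<le> f z"
  shows "0 \<le> circle_mean f"
  using circle_mean_mono[of "\<lambda>_. 0" f] assms by (simp add: circle_mean_const)

lemma has_integral_cis_int:
  "((\<lambda>\<theta>. cis (of_int k * \<theta>)) has_integral (if k = 0 then of_real (2*pi) else 0)) {0..2*pi}"
proof (cases "k = 0")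
  case True
  then show ?thesis
    using has_integral_const_real[of "1::complex" 0 "2*pi"] by (simp add: scaleR_conv_of_real)
next
  case False
  have "((\<lambda>\<theta>. cis (of_int k * \<theta>)) has_integral
      (cis (of_int k * (2*pi)) / (\<i> * of_int k) - cis (of_int k * 0) / (\<i> * of_int k))) {0..2*pi}"
    by (rule fundamental_theorem_of_calculus)
       (auto simp: cis_conv_exp False field_simps intro!: derivative_eq_intros has_vector_derivative_real_field)
  moreover have "cis (of_int k * (2*pi)) = 1"
    using cis_multiple_2pi[of "of_int k"] by (simp add: mult.commute)
  ultimately show ?thesis using False by simp
qed

lemma poly_eq_sum_lessThan:
  fixes P :: "'a::comm_semiring_1 poly"
  assumes "Polynomial.degree P < N"
  shows "poly P z = (\<Sum>i<N. Polynomial.coeff P i * z ^ i)"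
  unfolding poly_altdef
  by (rule sum.mono_neutral_left) (use assms in \<open>auto simp: coeff_eq_0\<close>)

text \<open>Parseval in polarised form, from the orthogonality of the functions
  \<open>cis (k * \<theta>)\<close>. The real part is taken because \<open>circle_mean\<close>
  averages real functions.\<close>

lemma circle_mean_inner:
  assumes "Polynomial.degree P < N" "Polynomial.degree Q < N"
  shows "circle_mean (\<lambda>z. Re (poly P z * cnj (poly Q z))) =
    (\<Sum>i<N. Re (Polynomial.coeff P i * cnj (Polynomial.coeff Q i)))"
proof -
  let ?p = "Polynomial.coeff P" and ?q = "Polynomial.coeff Q"
  have eq: "poly P (cis \<theta>) * cnj (poly Q (cis \<theta>)) =
      (\<Sum>i<N. \<Sum>j<N. ?p i * cnj (?q j) * cis (of_int (int i - int j) * \<theta>))" for \<theta>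
  proof -
    have "cis \<theta> ^ i * cnj (cis \<theta> ^ j) = cis (of_int (int i - int j) * \<theta>)" for i j
      by (simp only: Complex.DeMoivre cis_cnj cis_mult) (simp add: algebra_simps)
    then have "?p i * cis \<theta> ^ i * cnj (?q j * cis \<theta> ^ j) =
        ?p i * cnj (?q j) * cis (of_int (int i - int j) * \<theta>)" for i j
      by (simp only: complex_cnj_mult mult_ac)
    then show ?thesis
      by (simp only: poly_eq_sum_lessThan[OF assms(1)] poly_eq_sum_lessThan[OF assms(2)]
          cnj_sum sum_product)
  qed
  have "((\<lambda>\<theta>. poly P (cis \<theta>) * cnj (poly Q (cis \<theta>))) has_integral
      (\<Sum>i<N. \<Sum>j<N. ?p i * cnj (?q j) * (if int i - int j = 0 then of_real (2*pi) else 0))) {0..2*pi}"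
    unfolding eq by (intro has_integral_sum has_integral_mult_right has_integral_cis_int) auto
  also have "(\<Sum>i<N. \<Sum>j<N. ?p i * cnj (?q j) * (if int i - int j = 0 then of_real (2*pi) else 0)) =
      (\<Sum>i<N. \<Sum>j<N. if i = j then ?p i * cnj (?q j) * of_real (2*pi) else 0)"
    by (intro sum.cong refl) auto
  also have "\<dots> = (\<Sum>i<N. ?p i * cnj (?q i) * of_real (2*pi))"
    by (intro sum.cong refl) (simp add: sum.delta')
  also have "\<dots> = of_real (2*pi) * (\<Sum>i<N. ?p i * cnj (?q i))"
    by (simp only: sum_distrib_left mult.commute)
  finally have "((\<lambda>\<theta>. Re (poly P (cis \<theta>) * cnj (poly Q (cis \<theta>)))) has_integral
      Re (of_real (2*pi) * (\<Sum>i<N. ?p i * cnj (?q i)))) {0..2*pi}"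
    by (rule has_integral_Re)
  then have "integral {0..2*pi} (\<lambda>\<theta>. Re (poly P (cis \<theta>) * cnj (poly Q (cis \<theta>)))) =
      2 * pi * (\<Sum>i<N. Re (?p i * cnj (?q i)))"
    by (simp only: integral_unique Re_complex_of_real Re_sum times_complex.sel Im_complex_of_real)
  then show ?thesis unfolding circle_mean_def by simp
qed

lemma circle_mean_norm_square:
  assumes "Polynomial.degree P < N"
  shows "circle_mean (\<lambda>z. (cmod (poly P z))\<^sup>2) = (\<Sum>i<N. (cmod (Polynomial.coeff P i))\<^sup>2)"
  using circle_mean_inner[OF assms assms] by (simp only: complex_norm_square[symmetric] Re_complex_of_real of_real_power[symmetric])

section \<open>The merit factor through second and fourth moments\<close>

lemma inverse_merit_factor:
  assumes "circle_mean (\<lambda>z. (cmod (poly A z))\<^sup>2) \<noteq> 0"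
  shows "1 / merit_factor A =
    circle_mean (\<lambda>z. cmod (poly A z) ^ 4) / (circle_mean (\<lambda>z. (cmod (poly A z))\<^sup>2))\<^sup>2 - 1"
proof -
  have cont: "continuous_on UNIV (\<lambda>z. cmod (poly A z) ^ k)" for k
    by (intro continuous_intros)
  have nn: "0 \<le> circle_mean (\<lambda>z. cmod (poly A z) ^ k)" for k
    by (intro circle_mean_nonneg cont) auto
  have "lnorm 2 A = circle_mean (\<lambda>z. (cmod (poly A z))\<^sup>2) powr (1/2)"
    unfolding lnorm_def circle_mean_def by (simp add: powr_numeral)
  then have 2: "lnorm 2 A ^ 4 = (circle_mean (\<lambda>z. (cmod (poly A z))\<^sup>2))\<^sup>2"
    using nn[of 2] by (simp add: powr_half_sqrt power4_eq_xxxx power2_eq_square)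
  have "lnorm 4 A = circle_mean (\<lambda>z. cmod (poly A z) ^ 4) powr (1/4)"
    unfolding lnorm_def circle_mean_def by (simp add: powr_numeral)
  then have 4: "lnorm 4 A ^ 4 = circle_mean (\<lambda>z. cmod (poly A z) ^ 4)"
    using nn[of 4] by (simp add: powr_powr flip: powr_numeral)
  \<comment> \<open>If the two moments give a zero denominator, \<open>merit_factor A\<close> is 0
    by the convention on division, and both sides are 0.\<close>
  show ?thesis
    unfolding merit_factor_def 2 4 using assms by (simp add: field_simps)
qed

text \<open>Young's inequality for the exponents 4 and 4/3: the difference of the two sides has a
  double root at \<open>x = y\<close>, and the remaining quadratic factor is a sum of
  squares.\<close>

lemma young_4: "x * y ^ 3 \<le> x ^ 4 / 4 + 3 * y ^ 4 / 4" if "0 \<le> x" "0 \<le> y" for x y :: real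
proof -
  have "x ^ 4 + 3 * y ^ 4 - 4 * (x * y ^ 3) = (x - y)\<^sup>2 * ((x + y)\<^sup>2 + 2 * y\<^sup>2)"
    by (simp add: power2_eq_square power3_eq_cube power4_eq_xxxx algebra_simps)
  moreover have "0 \<le> (x - y)\<^sup>2 * ((x + y)\<^sup>2 + 2 * y\<^sup>2)" by simp
  ultimately show ?thesis by linarith
qed

subsection \<open>Fourth moments and residue classes\<close>

lemma degree_lt_sum_monom:
  assumes "0 < N"
  shows "Polynomial.degree (\<Sum>k<N. Polynomial.monom (c k) k) < N"
proof -
  have "Polynomial.degree (\<Sum>k<N. Polynomial.monom (c k) k) \<le> N - 1"
    by (intro degree_sum_le) (auto intro: order.trans[OF degree_monom_le])
  with assms show ?thesis by linarith
qed

text \<open>The fourth moment of \<open>B\<close> is the sum of the squared coefficients of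
  \<open>B * B\<close>. These coefficients add up to \<open>N^2\<close> and live on at most
  \<open>2 * N - 1\<close> indices, so Cauchy-Schwarz bounds the sum of squares below by
  \<open>N^4 / (2 * N)\<close>.\<close>

lemma arith_progression_fourth_moment:
  fixes B :: "complex poly"
  assumes "0 < N" "0 < p" and B: "B = (\<Sum>t<N. Polynomial.monom 1 (a + p * t))"
  shows "real N ^ 3 / 2 \<le> circle_mean (\<lambda>z. cmod (poly B z) ^ 4)"
proof -
  define T where "T = (\<lambda>t. a + a + p * t) ` {..<2 * N - 1}"
  \<comment> \<open>\<open>M\<close> exceeds the degree of \<open>B * B\<close> and every element of
    \<open>T\<close>, so sums over \<open>T\<close> and over \<open>{..<M}\<close> can be
    exchanged.\<close>
  define M where "M = Suc (Polynomial.degree (B * B)) + a + a + p * (2 * N)"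
  let ?c = "Polynomial.coeff (B * B)"
  have BB: "B * B = (\<Sum>s<N. \<Sum>t<N. Polynomial.monom 1 (a + a + p * (s + t)))"
    unfolding B sum_product by (intro sum.cong refl) (simp add: mult_monom algebra_simps)
  have coeff_0: "?c i = 0" if "i \<notin> T" for i
    unfolding BB coeff_sum using that by (intro sum.neutral ballI) (auto simp: T_def)
  have T_sub: "T \<subseteq> {..<M}" 
  proof
    fix i assume "i \<in> T"
    then obtain t where t: "t < 2 * N - 1" "i = a + a + p * t" by (auto simp: T_def)
    then have "p * t \<le> p * (2 * N)" by (intro mult_left_mono) auto
    with t(2) show "i \<in> {..<M}" unfolding M_def lessThan_iff by linarith
  qed
  have cardT: "card T \<le> 2 * N - 1"
    unfolding T_def using card_image_le[of "{..<2 * N - 1}"] by simp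
  have "poly (B * B) 1 = (\<Sum>i<M. ?c i)"
    by (subst poly_eq_sum_lessThan[of _ M]) (auto simp: M_def)
  also have "\<dots> = (\<Sum>i\<in>T. ?c i)"
    by (rule sum.mono_neutral_right) (use T_sub coeff_0 in auto)
  also have "poly (B * B) 1 = of_nat (N\<^sup>2)"
    unfolding B by (simp add: poly_sum poly_monom power2_eq_square)
  finally have "real (N\<^sup>2) = cmod (\<Sum>i\<in>T. ?c i)"
    by (metis norm_of_nat)
  also have "\<dots> \<le> (\<Sum>i\<in>T. cmod (?c i))"
    by (rule norm_sum)
  finally have "(real (N\<^sup>2))\<^sup>2 \<le> (\<Sum>i\<in>T. cmod (?c i))\<^sup>2"
    by (intro power_mono) auto
  also have "\<dots> \<le> (\<Sum>i\<in>T. (cmod (?c i))\<^sup>2) * real (card T)"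
    by (rule sum_squared_le_sum_of_squares)
  also have "\<dots> \<le> (\<Sum>i\<in>T. (cmod (?c i))\<^sup>2) * (2 * real N)"
    using cardT by (intro mult_left_mono sum_nonneg) auto
  also have "(\<Sum>i\<in>T. (cmod (?c i))\<^sup>2) = (\<Sum>i<M. (cmod (?c i))\<^sup>2)"
    by (rule sum.mono_neutral_left) (use T_sub coeff_0 in auto)
  also have "\<dots> = circle_mean (\<lambda>z. (cmod (poly (B * B) z))\<^sup>2)"
    by (rule circle_mean_norm_square[symmetric]) (simp add: M_def)
  also have "\<dots> = circle_mean (\<lambda>z. cmod (poly B z) ^ 4)"
    by (simp add: norm_mult power4_eq_xxxx power2_eq_square mult_ac)
  finally show ?thesis
    using assms(1) by (simp add: power4_eq_xxxx power3_eq_cube power2_eq_square field_simps)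
qed

lemma coeff_mult_nonzeroE:
  assumes "Polynomial.coeff (P * Q) i \<noteq> 0"
  obtains j where "j \<le> i" "Polynomial.coeff P j \<noteq> 0" "Polynomial.coeff Q (i - j) \<noteq> 0"
proof -
  obtain j where "j \<in> {..i}" "Polynomial.coeff P j * Polynomial.coeff Q (i - j) \<noteq> 0"
    using assms unfolding coeff_mult by (rule sum.not_neutral_contains_not_neutral)
  then show ?thesis by (intro that[of j]) auto
qed

text \<open>Testing against \<open>B\<bar>B\<bar>\<^sup>2\<close>, whose spectrum lies in a single residue class modulo \<open>p\<close>,
  only sees the part \<open>B\<close> of \<open>A\<close> in that class; Young's inequality then gives
  \<open>\<parallel>B\<parallel>\<^sub>4 \<le> \<parallel>A\<parallel>\<^sub>4\<close>.\<close>
lemma fourth_moment_ge_residue_class: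
  fixes A :: "complex poly"
  assumes "0 < N" "0 < p" "a < p"
    and deg: "Polynomial.degree A < p * N"
    and one: "\<And>j. j < p * N \<Longrightarrow> j mod p = a \<Longrightarrow> Polynomial.coeff A j = 1"
  shows "real N ^ 3 / 2 \<le> circle_mean (\<lambda>z. cmod (poly A z) ^ 4)"
proof -
  define B :: "complex poly" where "B = (\<Sum>t<N. Polynomial.monom 1 (a + p * t))"
  define D where "D = A - B"
  define M where "M = Suc (Polynomial.degree (A * B) + Polynomial.degree (D * B) + Polynomial.degree (B * B))"
  have coeffB: "Polynomial.coeff B j = (if j < p * N \<and> j mod p = a then 1 else 0)" for j
  proof -
    have "Polynomial.coeff B j = (\<Sum>t<N. if a + p * t = j then 1 else 0)"
      unfolding B_def by (simp add: coeff_sum)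
    also have "\<dots> = (\<Sum>t<N. if t = j div p then (if j mod p = a then 1 else 0) else 0)"
    proof (intro sum.cong refl)
      fix t
      have "a + p * t = j \<longleftrightarrow> t = j div p \<and> j mod p = a"
      proof
        assume "a + p * t = j"
        then show "t = j div p \<and> j mod p = a" using assms(2,3) by auto
      next
        assume "t = j div p \<and> j mod p = a"
        then show "a + p * t = j" using mod_mult_div_eq[of j p] by simp
      qed
      then show "(if a + p * t = j then 1 else 0) =
          (if t = j div p then if j mod p = a then 1 else 0 else (0::complex))" by auto
    qed
    also have "\<dots> = (if j < p * N \<and> j mod p = a then 1 else 0)"
      using assms(2) by (auto simp: sum.delta less_mult_imp_div_less mult.commute div_less_iff_less_mult)
    finally show ?thesis .
  qed
  have coeffD: "Polynomial.coeff D j = 0" if "j mod p = a" for j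
  proof (cases "j < p * N")
    case True
    with that one show ?thesis by (simp add: D_def coeffB)
  next
    case False
    then show ?thesis using deg that by (simp add: D_def coeffB coeff_eq_0)
  qed
  \<comment> \<open>Nonzero coefficients of \<open>B * B\<close> have index congruent to
    \<open>a + a\<close>, those of \<open>D * B\<close> index congruent to \<open>k + a\<close> with
    \<open>k\<close> outside the class of \<open>a\<close>; the two supports are disjoint.\<close>
  have ortho: "Polynomial.coeff (D * B) i * cnj (Polynomial.coeff (B * B) i) = 0" for i
  proof (rule ccontr)
    assume *: "\<not> ?thesis"
    then have "Polynomial.coeff (B * B) i \<noteq> 0" by auto
    then obtain j where "j \<le> i" "Polynomial.coeff B j \<noteq> 0" "Polynomial.coeff B (i - j) \<noteq> 0"
      by (rule coeff_mult_nonzeroE)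
    then have "j mod p = a" "(i - j) mod p = a" by (auto simp: coeffB split: if_splits)
    then have 1: "[a + a = i] (mod p)"
      using \<open>j \<le> i\<close> by (metis cong_def le_add_diff_inverse mod_add_eq mod_mod_trivial)
    from * have "Polynomial.coeff (D * B) i \<noteq> 0" by auto
    then obtain k where k: "k \<le> i" "Polynomial.coeff D k \<noteq> 0" "Polynomial.coeff B (i - k) \<noteq> 0"
      by (rule coeff_mult_nonzeroE)
    then have "(i - k) mod p = a" by (auto simp: coeffB split: if_splits)
    then have "[k + a = i] (mod p)"
      using k(1) by (metis cong_def le_add_diff_inverse mod_add_right_eq)
    with 1 have "[k + a = a + a] (mod p)" by (meson cong_sym cong_trans)
    then have "k mod p = a" using assms(3) by (simp add: cong_add_rcancel_nat) (simp add: cong_def)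
    with k(2) coeffD show False by blast
  qed
  have B4: "cmod (poly B z) ^ 4 = Re (poly (B * B) z * cnj (poly (B * B) z))" for z
    by (simp add: complex_norm_square[symmetric] norm_mult power4_eq_xxxx power2_eq_square
             del: of_real_mult complex_cnj_mult)
  have "circle_mean (\<lambda>z. Re (poly (A * B) z * cnj (poly (B * B) z))) =
      (\<Sum>i<M. Re (Polynomial.coeff (A * B) i * cnj (Polynomial.coeff (B * B) i)))"
    by (rule circle_mean_inner) (auto simp: M_def)
  also have "\<dots> = (\<Sum>i<M. Re (Polynomial.coeff (B * B) i * cnj (Polynomial.coeff (B * B) i)))"
  proof (intro sum.cong refl arg_cong[where f = Re])
    fix i
    have "A * B = D * B + B * B" by (simp add: D_def algebra_simps)
    then show "Polynomial.coeff (A * B) i * cnj (Polynomial.coeff (B * B) i) =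
        Polynomial.coeff (B * B) i * cnj (Polynomial.coeff (B * B) i)"
      using ortho[of i] by (simp add: distrib_right)
  qed
  also have "\<dots> = circle_mean (\<lambda>z. Re (poly (B * B) z * cnj (poly (B * B) z)))"
    by (rule circle_mean_inner[symmetric]) (auto simp: M_def)
  also have "\<dots> = circle_mean (\<lambda>z. cmod (poly B z) ^ 4)"
    by (simp only: B4)
  finally have "circle_mean (\<lambda>z. cmod (poly B z) ^ 4) =
      circle_mean (\<lambda>z. Re (poly (A * B) z * cnj (poly (B * B) z)))" ..
  \<comment> \<open>The integrand is at most |A| |B|^3, which Young's inequality splits; the share
    3/4 of the fourth moment of \<open>B\<close> is then absorbed on the left.\<close>
  also have "\<dots> \<le> circle_mean (\<lambda>z. 1/4 * cmod (poly A z) ^ 4 + 3/4 * cmod (poly B z) ^ 4)"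
  proof (rule circle_mean_mono)
    fix z :: complex
    have "Re (poly (A * B) z * cnj (poly (B * B) z)) \<le> cmod (poly (A * B) z * cnj (poly (B * B) z))"
      by (rule complex_Re_le_cmod)
    also have "\<dots> = cmod (poly A z) * cmod (poly B z) ^ 3"
      by (simp add: norm_mult power3_eq_cube)
    also have "\<dots> \<le> 1/4 * cmod (poly A z) ^ 4 + 3/4 * cmod (poly B z) ^ 4"
      using young_4[of "cmod (poly A z)" "cmod (poly B z)"] by simp
    finally show "Re (poly (A * B) z * cnj (poly (B * B) z))
        \<le> 1/4 * cmod (poly A z) ^ 4 + 3/4 * cmod (poly B z) ^ 4" .
  qed (intro continuous_intros)+
  also have "\<dots> = 1/4 * circle_mean (\<lambda>z. cmod (poly A z) ^ 4) + 3/4 * circle_mean (\<lambda>z. cmod (poly B z) ^ 4)"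
    by (subst circle_mean_add) (auto intro!: continuous_intros simp only: circle_mean_cmult)
  finally have "circle_mean (\<lambda>z. cmod (poly B z) ^ 4) \<le> circle_mean (\<lambda>z. cmod (poly A z) ^ 4)"
    by simp
  with arith_progression_fourth_moment[OF assms(1,2) B_def] show ?thesis by linarith
qed

subsection \<open>Bounding a polynomial by its values at roots of unity\<close>

text \<open>Concavity of sine puts \<open>sin (pi * y)\<close> above the chord \<open>2 * y\<close>
  on [0, 1/2], and the symmetry between \<open>x\<close> and \<open>1 - x\<close> handles the other
  half. The symmetric right-hand side spares a case distinction when the bound is summed.\<close>

lemma inverse_sin_pi_le:
  assumes "0 < x" "x < 1"
  shows "1 / sin (pi * x) \<le> (1 / x + 1 / (1 - x)) / 2"
proof -
  have half: "2 * y \<le> sin (pi * y)" if "0 \<le> y" "y \<le> 1/2" for y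
  proof -
    have conc: "concave_on {0..pi} sin"
      by (rule f''_le0_imp_concave[where f' = cos and f'' = "\<lambda>x. - sin x"])
         (auto intro!: derivative_eq_intros sin_ge_zero)
    have "(1 - 2 * y) * sin 0 + (2 * y) * sin (pi/2) \<le> sin ((1 - 2 * y) *\<^sub>R 0 + (2 * y) *\<^sub>R (pi/2))"
      using that by (intro concave_onD[OF conc]) auto
    then show ?thesis by (simp add: mult_ac)
  qed
  have inv_half: "1 / (2 * y) = (1 / y) / 2" for y :: real by simp
  have eq: "sin (pi * (1 - x)) = sin (pi * x)"
    by (simp add: right_diff_distrib)
  show ?thesis
  proof (cases "x \<le> 1/2")
    case True
    with half[of x] assms have "1 / sin (pi * x) \<le> 1 / (2 * x)"
      by (intro divide_left_mono) auto
    also have "1 / (2 * x) \<le> (1 / x + 1 / (1 - x)) / 2"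
      using assms inv_half divide_pos_pos[of 1 x] divide_pos_pos[of 1 "1 - x"] by (smt (verit) divide_right_mono)
    finally show ?thesis .
  next
    case False
    with half[of "1 - x"] assms eq have "1 / sin (pi * x) \<le> 1 / (2 * (1 - x))"
      by (intro divide_left_mono) auto
    also have "1 / (2 * (1 - x)) \<le> (1 / x + 1 / (1 - x)) / 2"
      using assms inv_half divide_pos_pos[of 1 x] divide_pos_pos[of 1 "1 - x"] by (smt (verit) divide_right_mono)
    finally show ?thesis .
  qed
qed

lemma norm_one_minus_cis: "cmod (1 - cis (2 * t)) = 2 * \<bar>sin t\<bar>"
proof -
  have "(cmod (1 - cis (2 * t)))\<^sup>2 = (2 * \<bar>sin t\<bar>)\<^sup>2"
  proof -
    have ring: "(2 * a\<^sup>2)\<^sup>2 + (- (2 * a * b))\<^sup>2 = 4 * a\<^sup>2 * (a\<^sup>2 + b\<^sup>2)" for a b :: real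
      by (simp add: power2_eq_square algebra_simps)
    have "Re (1 - cis (2 * t)) = 2 * (sin t)\<^sup>2" "Im (1 - cis (2 * t)) = - (2 * sin t * cos t)"
      by (simp_all add: cos_double_sin sin_double)
    then have "(cmod (1 - cis (2 * t)))\<^sup>2 = 4 * (sin t)\<^sup>2 * ((sin t)\<^sup>2 + (cos t)\<^sup>2)"
      unfolding cmod_power2 by (simp only: ring)
    then show ?thesis by (simp add: power_mult_distrib)
  qed
  then show ?thesis by (rule power2_eq_imp_eq) auto
qed

text \<open>Bound for the Dirichlet kernel, uniform in \<open>n\<close>: in the closed form of the
  geometric sum the numerator is at most 2 in modulus and the denominator has modulus
  \<open>2 * sin (pi * x)\<close>.\<close>

lemma norm_geometric_sum_cis_le:
  assumes "0 < x" "x < 1"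
  shows "cmod (\<Sum>j<n. cis (2 * pi * x) ^ j) \<le> (1 / x + 1 / (1 - x)) / 2"
proof -
  let ?w = "cis (2 * pi * x)"
  have pos: "0 < sin (pi * x)"
    using assms by (intro sin_gt_zero) auto
  have nw: "cmod (1 - ?w) = 2 * sin (pi * x)"
    using norm_one_minus_cis[of "pi * x"] pos by (simp add: mult.assoc)
  then have "?w \<noteq> 1" using pos by auto
  then have "(\<Sum>j<n. ?w ^ j) = (1 - ?w ^ n) / (1 - ?w)"
    by (simp add: sum_gp_strict)
  then have "cmod (\<Sum>j<n. ?w ^ j) = cmod (1 - ?w ^ n) / (2 * sin (pi * x))"
    by (simp add: norm_divide nw)
  also have "\<dots> \<le> 2 / (2 * sin (pi * x))"
    using norm_triangle_ineq4[of 1 "?w ^ n"] pos by (intro divide_right_mono) (auto simp: norm_power)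
  also have "\<dots> = 1 / sin (pi * x)" by simp
  also have "\<dots> \<le> (1 / x + 1 / (1 - x)) / 2"
    by (rule inverse_sin_pi_le) (use assms in auto)
  finally show ?thesis .
qed

lemma sum_cis_orthogonal:
  fixes n :: nat and d :: int
  assumes "0 < n"
  shows "(\<Sum>k<n. cis (2 * pi * of_int (int k * d) / real n)) = (if int n dvd d then of_nat n else 0)"
proof -
  let ?w = "cis (2 * pi * of_int d / real n)"
  have eq: "cis (2 * pi * of_int (int k * d) / real n) = ?w ^ k" for k
    by (simp add: Complex.DeMoivre mult_ac)
  show ?thesis
  proof (cases "int n dvd d")
    case True
    then obtain q where "d = int n * q" by auto
    then have "?w = 1" using assms cis_multiple_2pi[of "of_int q"] by (simp add: mult.assoc)
    then show ?thesis unfolding eq using True by simp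
  next
    case False
    have "?w \<noteq> 1"
    proof
      assume "?w = 1"
      then have "cos (2 * pi * of_int d / real n) = 1" by (simp add: complex_eq_iff)
      then obtain q :: int where "2 * pi * of_int d / real n = of_int q * 2 * pi"
        by (auto simp: cos_one_2pi_int)
      then have "of_int d = (of_int (q * int n) :: real)" using assms by (simp add: field_simps)
      then have "d = q * int n" by (simp only: of_int_eq_iff)
      with False show False by auto
    qed
    moreover have "?w ^ n = 1"
      using assms by (simp add: Complex.DeMoivre)
    ultimately show ?thesis unfolding eq using False by (simp add: sum_gp_strict)
  qed
qed

text \<open>The sequence \<open>harm n - ln n\<close> is decreasing and equals 1 at
  \<open>n = 1\<close>.\<close>

lemma sum_inverse_le_one_plus_ln: "(\<Sum>k=1..m. 1 / real k) \<le> 1 + ln (real n)" if "m \<le> n" "0 < n"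
proof -
  have "(\<Sum>k=1..m. 1 / real k) = harm m" by (simp add: harm_def inverse_eq_divide)
  also have "\<dots> \<le> harm n" using that by (intro harm_mono)
  also have "\<dots> \<le> 1 + ln (real n)"
    using euler_mascheroni_sequence_decreasing[of 1 n] that by (simp add: harm_expand)
  finally show ?thesis .
qed

text \<open>Interpolation at the \<open>n\<close>-th roots of unity writes \<open>P\<close> as the
  mean of its node values weighted by Dirichlet kernels; the factor \<open>3 + ln n\<close> bounds
  the mean modulus of these kernels.\<close>

lemma norm_poly_le_of_roots_of_unity:
  assumes n: "0 < n" and deg: "Polynomial.degree P < n"
    and bound: "\<And>m::int. cmod (poly P (cis (2 * pi * of_int m / real n))) \<le> G"
    and z: "cmod z = 1"
  shows "cmod (poly P z) \<le> G * (3 + ln (real n))"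
proof -
  have G: "0 \<le> G" using bound[of 0] by (meson norm_ge_zero order_trans)
  obtain \<theta> where \<theta>: "z = cis \<theta>"
    using z complex_norm_eq_1_exp[of z] by (metis cis_conv_exp)
  \<comment> \<open>The point \<open>z\<close> lies between the roots of index \<open>m\<close> and
    \<open>m + 1\<close>. Numbering the nodes \<open>\<zeta> k\<close> backwards from
    \<open>m\<close> makes the angle from \<open>\<zeta> k\<close> to \<open>z\<close> equal to
    \<open>2 * pi * (\<tau> + k) / n\<close>, an increasing function of \<open>k\<close>.\<close>
  define m :: int where "m = \<lfloor>\<theta> * n / (2 * pi)\<rfloor>"
  define \<tau> where "\<tau> = \<theta> * n / (2 * pi) - of_int m"
  have \<tau>: "0 \<le> \<tau>" "\<tau> < 1" unfolding \<tau>_def m_def by linarith+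
  have \<theta>_eq: "\<theta> = 2 * pi * (of_int m + \<tau>) / n"
    using n by (simp add: \<tau>_def field_simps)
  define \<zeta> where "\<zeta> k = cis (2 * pi * of_int (m - int k) / real n)" for k :: nat
  define D where "D x = (\<Sum>j<n. cis (2 * pi * x) ^ j)" for x
  have D: "D ((\<tau> + real k) / n) = (\<Sum>j<n. (z * inverse (\<zeta> k)) ^ j)" for k
    unfolding D_def \<zeta>_def \<theta> \<theta>_eq cis_inverse cis_mult
    by (intro sum.cong refl arg_cong2[where f = "(^)"] arg_cong[where f = cis])
       (simp add: add_divide_distrib diff_divide_distrib algebra_simps)
  let ?a = "Polynomial.coeff P"
  have ortho: "(\<Sum>k<n. \<zeta> k ^ i * inverse (\<zeta> k) ^ j) = (if i = j then of_nat n else 0)"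
    if "i < n" "j < n" for i j
  proof -
    have "\<zeta> k ^ i * inverse (\<zeta> k) ^ j =
        cis (2 * pi * of_int (m * (int i - int j)) / n) * cis (2 * pi * of_int (int k * (int j - int i)) / n)" for k
      unfolding \<zeta>_def cis_inverse Complex.DeMoivre cis_mult
      by (rule arg_cong[where f = cis]) (use n in \<open>simp add: field_simps\<close>)
    then have "(\<Sum>k<n. \<zeta> k ^ i * inverse (\<zeta> k) ^ j) =
        cis (2 * pi * of_int (m * (int i - int j)) / n) * (if int n dvd int j - int i then of_nat n else 0)"
      unfolding sum_cis_orthogonal[OF n, symmetric] by (simp add: sum_distrib_left)
    also have "int n dvd int j - int i \<longleftrightarrow> i = j"
    proof
      assume "int n dvd int j - int i"
      then have "int j mod int n = int i mod int n" by (simp add: mod_eq_dvd_iff)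
      then show "i = j" using that by simp
    qed auto
    finally show ?thesis by auto
  qed
  \<comment> \<open>Expanding both factors and summing over the nodes first, discrete orthogonality
    keeps only the diagonal \<open>i = j\<close>.\<close>
  have "(\<Sum>k<n. poly P (\<zeta> k) * D ((\<tau> + real k) / n)) =
      (\<Sum>k<n. \<Sum>i<n. \<Sum>j<n. ?a i * z ^ j * (\<zeta> k ^ i * inverse (\<zeta> k) ^ j))"
    unfolding D poly_eq_sum_lessThan[OF deg] sum_product
    by (intro sum.cong refl) (simp only: power_mult_distrib mult_ac)
  also have "\<dots> = (\<Sum>i<n. \<Sum>j<n. \<Sum>k<n. ?a i * z ^ j * (\<zeta> k ^ i * inverse (\<zeta> k) ^ j))"
    by (subst sum.swap, rule sum.cong[OF refl], rule sum.swap)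
  also have "\<dots> = (\<Sum>i<n. \<Sum>j<n. if i = j then of_nat n * (?a i * z ^ j) else 0)"
    unfolding sum_distrib_left[symmetric] by (intro sum.cong refl) (auto simp: ortho)
  also have "\<dots> = of_nat n * poly P z"
    unfolding poly_eq_sum_lessThan[OF deg] sum_distrib_left by (simp add: sum.delta')
  finally have interp: "of_nat n * poly P z = (\<Sum>k<n. poly P (\<zeta> k) * D ((\<tau> + real k) / n))" ..
  \<comment> \<open>This serves the two nodes next to \<open>z\<close>, \<open>k = 0\<close> and
    \<open>k = n - 1\<close>, where the kernel bound can blow up.\<close>
  have D_triv: "cmod (D x) \<le> n" for x
    unfolding D_def by (rule order.trans[OF norm_sum]) (simp add: norm_power)
  \<comment> \<open>Since \<open>\<tau> < 1\<close>, the distance \<open>n - (\<tau> + k)\<close> is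
    at least \<open>n - 1 - k\<close>, which is positive in this range.\<close>
  have D_le: "cmod (D ((\<tau> + real k) / n)) \<le> real n / 2 * (1 / real k + 1 / real (n - 1 - k))"
    if "1 \<le> k" "k < n - 1" for k
  proof -
    let ?x = "(\<tau> + real k) / n"
    have x: "0 < ?x" "?x < 1" using that \<tau> n by (auto simp: field_simps)
    have "cmod (D ?x) \<le> (1 / ?x + 1 / (1 - ?x)) / 2"
      unfolding D_def by (rule norm_geometric_sum_cis_le[OF x])
    also have "1 / ?x \<le> real n * (1 / real k)"
      using that \<tau> by (simp add: field_simps)
    also have "1 / (1 - ?x) = real n / (real n - (\<tau> + real k))"
      using n by (simp add: field_simps)
    also have "\<dots> \<le> real n / real (n - 1 - k)"
      using that \<tau> by (intro divide_left_mono mult_pos_pos) auto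
    finally show ?thesis by (simp add: field_simps)
  qed
  have "(\<Sum>k<n. cmod (D ((\<tau> + real k) / n))) \<le> real n * (3 + ln (real n))"
  proof (cases "n = 1")
    case True
    then show ?thesis using D_triv by simp (smt (verit) D_triv True of_nat_1)
  next
    case False
    with n have n2: "n \<ge> 2" by simp
    then have "{..<n} = insert 0 (insert (n - 1) {1..<n - 1})" by auto
    then have "(\<Sum>k<n. cmod (D ((\<tau> + real k) / n))) = cmod (D ((\<tau> + real 0) / n)) +
        (cmod (D ((\<tau> + real (n - 1)) / n)) + (\<Sum>k=1..<n-1. cmod (D ((\<tau> + real k) / n))))"
      using n2 by (simp only:) (subst sum.insert, auto)
    \<comment> \<open>The constant 3 arises here: 2 from the two adjacent nodes, and
      \<open>1 + ln n\<close> from the average of two harmonic sums.\<close>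
    also have "\<dots> \<le> real n + (real n + (\<Sum>k=1..<n-1. real n / 2 * (1 / real k + 1 / real (n - 1 - k))))"
      by (intro add_mono D_triv sum_mono D_le) auto
    also have "(\<Sum>k=1..<n-1. real n / 2 * (1 / real k + 1 / real (n - 1 - k))) =
        real n / 2 * ((\<Sum>k=1..<n-1. 1 / real k) + (\<Sum>k=1..<n-1. 1 / real (n - 1 - k)))"
      by (simp only: sum_distrib_left[symmetric] sum.distrib)
    also have "(\<Sum>k=1..<n-1. 1 / real (n - 1 - k)) = (\<Sum>k=1..<n-1. 1 / real k)"
      by (rule sum.reindex_bij_witness[of _ "\<lambda>k. n - 1 - k" "\<lambda>k. n - 1 - k"]) auto
    also have "{1..<n-1} = {1..n-2}" using n2 by auto
    also have "real n + (real n + real n / 2 * ((\<Sum>k=1..n-2. 1 / real k) + (\<Sum>k=1..n-2. 1 / real k)))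
        \<le> real n + (real n + real n / 2 * ((1 + ln (real n)) + (1 + ln (real n))))"
      by (intro add_mono mult_left_mono sum_inverse_le_one_plus_ln order.refl) (use n2 in auto)
    finally show ?thesis by (simp add: algebra_simps)
  qed
  moreover have "real n * cmod (poly P z) \<le> (\<Sum>k<n. G * cmod (D ((\<tau> + real k) / n)))"
  proof -
    have "real n * cmod (poly P z) = cmod (\<Sum>k<n. poly P (\<zeta> k) * D ((\<tau> + real k) / n))"
      unfolding interp[symmetric] by (simp add: norm_mult)
    also have "\<dots> \<le> (\<Sum>k<n. G * cmod (D ((\<tau> + real k) / n)))"
      by (rule order.trans[OF norm_sum])
         (auto intro!: sum_mono mult_right_mono bound simp: norm_mult \<zeta>_def simp del: of_int_diff)
    finally show ?thesis .
  qed
  ultimately have "real n * cmod (poly P z) \<le> G * (real n * (3 + ln (real n)))"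
    using G unfolding sum_distrib_left[symmetric] by (meson mult_left_mono order_trans)
  then show ?thesis using n by (simp add: mult.left_commute)
qed

subsection \<open>The Jacobi symbol\<close>

lemma Legendre_cong: "[a = b] (mod p) \<Longrightarrow> Legendre a p = Legendre b p"
proof -
  assume ab: "[a = b] (mod p)"
  then have "[a = 0] (mod p) \<longleftrightarrow> [b = 0] (mod p)" "\<And>y. [y\<^sup>2 = a] (mod p) \<longleftrightarrow> [y\<^sup>2 = b] (mod p)"
    by (meson cong_sym cong_trans)+
  then show ?thesis by (simp add: Legendre_def QuadRes_def)
qed

lemma Legendre_eq_0_iff: "Legendre a p = 0 \<longleftrightarrow> p dvd a"
  by (simp add: Legendre_def cong_0_iff)

lemma Legendre_values: "Legendre a p \<in> {-1, 0, 1}"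
  by (simp add: Legendre_def)

text \<open>Two such values differ by at most 2. This turns the congruences supplied by Euler's
  criterion into equalities.\<close>

lemma sign_values_cong_imp_eq:
  fixes x y :: int
  assumes "x \<in> {-1, 0, 1}" "y \<in> {-1, 0, 1}" "[x = y] (mod int p)" "2 < p"
  shows "x = y"
proof (rule ccontr)
  assume "x \<noteq> y"
  from assms(3) have "int p dvd x - y" by (simp add: cong_iff_dvd_diff)
  with \<open>x \<noteq> y\<close> have "int p \<le> \<bar>x - y\<bar>"
    by (metis dvd_imp_le_int abs_of_nat right_minus_eq)
  then show False using assms by auto
qed

lemma Legendre_mult:
  assumes "prime p" "2 < p"
  shows "Legendre (a * b) (int p) = Legendre a (int p) * Legendre b (int p)"
proof (rule sign_values_cong_imp_eq[of _ _ p])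
  have "[Legendre a (int p) * Legendre b (int p) = a ^ ((p - 1) div 2) * b ^ ((p - 1) div 2)] (mod int p)"
    by (intro cong_mult euler_criterion assms)
  moreover have "[Legendre (a * b) (int p) = (a * b) ^ ((p - 1) div 2)] (mod int p)"
    by (intro euler_criterion assms)
  ultimately show "[Legendre (a * b) (int p) = Legendre a (int p) * Legendre b (int p)] (mod int p)"
    by (metis cong_sym cong_trans power_mult_distrib)
next
  show "Legendre a (int p) * Legendre b (int p) \<in> {-1, 0, 1}"
    using Legendre_values[of a "int p"] Legendre_values[of b "int p"] by auto
qed (use Legendre_values assms in auto)

lemma Legendre_1: "1 < p \<Longrightarrow> Legendre 1 p = 1"
proof -
  assume "1 < p"
  moreover have "QuadRes p 1" unfolding QuadRes_def by (rule exI[of _ 1]) simp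
  ultimately show ?thesis by (auto simp: Legendre_def cong_0_iff)
qed

text \<open>A primitive root is a nonresidue: otherwise Euler's criterion would force its order
  \<open>p - 1\<close> to divide \<open>(p - 1) div 2\<close>.\<close>

lemma exists_Legendre_neg:
  assumes "prime p" "2 < p"
  shows "\<exists>g. Legendre g (int p) = -1"
proof -
  obtain g where g: "residue_primroot p g"
    using prime_primitive_root_exists[of p] assms prime_gt_1_nat by blast
  then have ord: "ord p g = p - 1" and cop: "coprime p g"
    using assms by (auto simp: residue_primroot_def totient_prime)
  have "Legendre (int g) (int p) \<noteq> 1"
  proof
    assume "Legendre (int g) (int p) = 1"
    then have "[int g ^ ((p - 1) div 2) = 1] (mod int p)"
      using euler_criterion[OF assms, of "int g"] by (simp add: cong_sym)
    then have "[g ^ ((p - 1) div 2) = 1] (mod p)"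
      by (metis cong_int_iff of_nat_1 of_nat_power)
    then have "p - 1 dvd (p - 1) div 2"
      by (metis ord ord_divides)
    then show False using assms by (auto dest!: dvd_imp_le)
  qed
  moreover have "\<not> int p dvd int g"
    using cop assms by (metis coprime_absorb_left int_dvd_int_iff not_prime_unit)
  ultimately show ?thesis
    using Legendre_values[of "int g" "int p"] by (auto simp: Legendre_eq_0_iff)
qed

lemma jacobi_mult:
  assumes "odd n"
  shows "jacobi (a * b) n = jacobi a n * jacobi b n"
proof -
  have "(\<Prod>p\<in>#prime_factorization n. Legendre (a * b) (int p)) =
      (\<Prod>p\<in>#prime_factorization n. Legendre a (int p) * Legendre b (int p))"
  proof (intro arg_cong[where f = prod_mset] image_mset_cong)
    fix p assume "p \<in># prime_factorization n"
    then have "prime p" "p dvd n" by auto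
    then have "2 < p" using assms prime_gt_1_nat[of p] by (cases "p = 2") auto
    with \<open>prime p\<close> show "Legendre (a * b) (int p) = Legendre a (int p) * Legendre b (int p)"
      by (rule Legendre_mult)
  qed
  then show ?thesis by (simp add: jacobi_def prod_mset.distrib)
qed

lemma jacobi_cong:
  assumes "[a = b] (mod int n)"
  shows "jacobi a n = jacobi b n"
  unfolding jacobi_def
proof (intro arg_cong[where f = prod_mset] image_mset_cong Legendre_cong)
  fix p assume "p \<in># prime_factorization n"
  then have "int p dvd int n" by auto
  then show "[a = b] (mod int p)" using assms by (rule cong_dvd_modulus[rotated])
qed

lemma jacobi_1: "jacobi 1 n = 1"
proof -
  have "image_mset (\<lambda>p. Legendre 1 (int p)) (prime_factorization n) = image_mset (\<lambda>p. 1) (prime_factorization n)"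
  proof (rule image_mset_cong)
    fix p assume "p \<in># prime_factorization n"
    then have "1 < int p" using prime_gt_1_nat[of p] by auto
    then show "Legendre 1 (int p) = 1" by (rule Legendre_1)
  qed
  then show ?thesis by (simp add: jacobi_def)
qed

lemma jacobi_eq_0_iff:
  assumes "0 < n"
  shows "jacobi a n = 0 \<longleftrightarrow> \<not> coprime a (int n)"
proof -
  have "jacobi a n = 0 \<longleftrightarrow> (\<exists>p\<in>prime_factors n. int p dvd a)"
    by (auto simp: jacobi_def prod_mset_zero_iff Legendre_eq_0_iff)
  also have "\<dots> \<longleftrightarrow> \<not> coprime (nat \<bar>a\<bar>) n"
  proof -
    have dvd_iff: "int p dvd a \<longleftrightarrow> p dvd nat \<bar>a\<bar>" for p
      by (simp add: int_dvd_int_iff[symmetric] del: int_dvd_int_iff)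
    show ?thesis
    proof
      assume "\<exists>p\<in>prime_factors n. int p dvd a"
      then obtain p where p: "prime p" "p dvd n" "p dvd nat \<bar>a\<bar>"
        unfolding dvd_iff by (blast dest: in_prime_factors_imp_prime in_prime_factors_imp_dvd)
      show "\<not> coprime (nat \<bar>a\<bar>) n"
      proof
        assume "coprime (nat \<bar>a\<bar>) n"
        then have "is_unit p" using p(3,2) by (rule coprime_common_divisor)
        with p(1) show False by auto
      qed
    next
      assume "\<not> coprime (nat \<bar>a\<bar>) n"
      then have "gcd (nat \<bar>a\<bar>) n \<noteq> 1" by (simp add: coprime_iff_gcd_eq_1)
      then obtain p where "prime p" "p dvd gcd (nat \<bar>a\<bar>) n" using prime_factor_nat by blast
      then have "p \<in> prime_factors n" "int p dvd a"
        unfolding dvd_iff using assms by (simp_all only: prime_factors_dvd mem_Collect_eq gcd_nat.bounded_iff)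
      then show "\<exists>p\<in>prime_factors n. int p dvd a" by blast
    qed
  qed
  also have "coprime (nat \<bar>a\<bar>) n \<longleftrightarrow> coprime a (int n)"
    by (simp add: coprime_int_iff[symmetric] del: coprime_int_iff)
  finally show ?thesis .
qed

lemma jacobi_values: "jacobi a n \<in> {-1, 0, 1}"
proof -
  have "prod_mset (image_mset (\<lambda>p. Legendre a (int p)) M) \<in> {-1, 0, 1}" for M
  proof (induction M)
    case (add x M)
    then show ?case using Legendre_values[of a "int x"] by auto
  qed simp
  then show ?thesis by (simp add: jacobi_def)
qed

lemma jacobi_abs:
  assumes "0 < n"
  shows "\<bar>jacobi a n\<bar> = (if coprime a (int n) then 1 else 0)"
  using jacobi_values[of a n] jacobi_eq_0_iff[OF assms, of a] by auto

text \<open>Primitivity of the character. A prime \<open>q\<close> divides both \<open>m\<close> and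
  \<open>n\<close>, and square-freeness makes \<open>q\<close> coprime to \<open>k = n / q\<close>.
  By the Chinese remainder theorem some \<open>u\<close> is a nonresidue modulo \<open>q\<close> and
  1 modulo \<open>k\<close>; then \<open>q * k\<close> divides \<open>m * (u - 1)\<close>.\<close>

lemma jacobi_primitive:
  assumes "odd n" "squarefree n" "\<not> coprime m (int n)"
  obtains u where "jacobi u n = -1" "[m * u = m] (mod int n)"
proof -
  have n: "0 < n" using assms(1) by (cases n) auto
  from assms(3) obtain q where q: "prime q" "q dvd n" "int q dvd m"
  proof -
    have "jacobi m n = 0" using assms(3) n by (simp add: jacobi_eq_0_iff)
    then have "\<exists>q\<in>prime_factors n. int q dvd m"
      by (auto simp: jacobi_def prod_mset_zero_iff Legendre_eq_0_iff)
    then show ?thesis using that by auto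
  qed
  then obtain k where k: "n = q * k" by auto
  have q2: "2 < q" using q assms(1) prime_gt_1_nat[of q] by (cases "q = 2") auto
  have cop: "coprime q k"
  proof (rule ccontr)
    assume "\<not> coprime q k"
    then have "q dvd k" using q(1) prime_imp_coprime_nat by blast
    then have "q\<^sup>2 dvd n" by (auto simp: k power2_eq_square)
    then show False using assms(2) q(1) unfolding squarefree_def by (metis not_prime_unit)
  qed
  obtain g where g: "Legendre g (int q) = -1" using exists_Legendre_neg[OF q(1) q2] by auto
  obtain u where u: "[u = g] (mod int q)" "[u = 1] (mod int k)"
    using binary_chinese_remainder_int[of "int q" "int k" g 1] cop by auto
  have "prime_factorization n = {#q#} + prime_factorization k"
    using q(1) n k by (simp add: prime_factorization_mult prime_factorization_prime)
  then have "jacobi u n = Legendre u (int q) * jacobi u k"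
    by (simp add: jacobi_def)
  also have "\<dots> = -1"
    using Legendre_cong[OF u(1)] g jacobi_cong[OF u(2)] by (simp add: jacobi_1)
  finally have "jacobi u n = -1" .
  moreover have "[m * u = m] (mod int n)"
  proof -
    have "int k dvd u - 1" using u(2) by (simp add: cong_iff_dvd_diff)
    with q(3) have "int q * int k dvd m * (u - 1)" by (rule mult_dvd_mono)
    then show ?thesis by (simp add: k cong_iff_dvd_diff right_diff_distrib)
  qed
  ultimately show ?thesis by (rule that)
qed

subsection \<open>Gauss sums\<close>

text \<open>A map injective modulo \<open>n\<close> permutes the residues. Working over the integers
  admits negative shifts, which occur for negative \<open>r\<close>.\<close>

lemma sum_residues_reindex:
  fixes f :: "int \<Rightarrow> 'a::comm_monoid_add"
  assumes n: "0 < n" and f: "\<And>x y. [x = y] (mod int n) \<Longrightarrow> f x = f y"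
    and g: "\<And>x y. [g x = g y] (mod int n) \<Longrightarrow> [x = y] (mod int n)"
  shows "(\<Sum>k<n. f (g (int k))) = (\<Sum>k<n. f (int k))"
proof -
  define h where "h k = nat (g (int k) mod int n)" for k :: nat
  have hn: "h k < n" for k
    using n by (simp add: h_def nat_less_iff)
  have hc: "[int (h k) = g (int k)] (mod int n)" for k
    using n by (simp add: h_def)
  have inj: "inj_on h {..<n}"
  proof (rule inj_onI)
    fix x y assume xy: "x \<in> {..<n}" "y \<in> {..<n}" "h x = h y"
    then have "[g (int x) = g (int y)] (mod int n)" using hc by (metis cong_sym cong_trans)
    then have "[int x = int y] (mod int n)" by (rule g)
    then show "x = y" using xy by (simp add: cong_int_iff cong_less_modulus_unique_nat)
  qed
  then have img: "h ` {..<n} = {..<n}"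
    using hn by (intro endo_inj_surj) auto
  have "(\<Sum>k<n. f (g (int k))) = (\<Sum>k<n. f (int (h k)))"
    by (intro sum.cong refl f cong_sym[OF hc])
  also have "\<dots> = (\<Sum>k\<in>h ` {..<n}. f (int k))"
    by (simp add: sum.reindex[OF inj])
  finally show ?thesis by (simp add: img)
qed

lemma sum_residues_shift:
  fixes f :: "int \<Rightarrow> 'a::comm_monoid_add"
  assumes "0 < n" "\<And>x y. [x = y] (mod int n) \<Longrightarrow> f x = f y"
  shows "(\<Sum>k<n. f (int k + s)) = (\<Sum>k<n. f (int k))"
  using assms by (rule sum_residues_reindex[where g = "\<lambda>x. x + s"]) (simp_all add: cong_add_rcancel)

lemma sum_residues_mult:
  fixes f :: "int \<Rightarrow> 'a::comm_monoid_add"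
  assumes "0 < n" "\<And>x y. [x = y] (mod int n) \<Longrightarrow> f x = f y" "coprime u (int n)"
  shows "(\<Sum>k<n. f (u * int k)) = (\<Sum>k<n. f (int k))"
  using assms(1,2) by (rule sum_residues_reindex[where g = "\<lambda>x. u * x"]) (simp_all add: cong_mult_lcancel assms(3))

definition unity_root :: "nat \<Rightarrow> int \<Rightarrow> complex" where
  "unity_root n x = cis (2 * pi * of_int x / real n)"

lemma norm_unity_root [simp]: "cmod (unity_root n x) = 1"
  by (simp add: unity_root_def)

lemma unity_root_add: "unity_root n (x + y) = unity_root n x * unity_root n y"
  by (simp add: unity_root_def cis_mult add_divide_distrib distrib_left)

lemma unity_root_cong:
  assumes "0 < n" "[x = y] (mod int n)"
  shows "unity_root n x = unity_root n y"
proof -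
  from assms(2) obtain q where "x = y + int n * q"
    by (metis cong_iff_lin cong_sym)
  moreover have "unity_root n (int n * q) = 1"
    using assms(1) cis_multiple_2pi[of "of_int q"] by (simp add: unity_root_def mult.assoc)
  ultimately show ?thesis by (simp add: unity_root_add)
qed

text \<open>Parseval's identity for the Fourier transform on the residues modulo
  \<open>n\<close>.\<close>

lemma sum_norm_square_dft:
  fixes x :: "nat \<Rightarrow> complex"
  assumes n: "0 < n"
  shows "(\<Sum>m<n. (cmod (\<Sum>k<n. x k * unity_root n (int m * int k)))\<^sup>2) = real n * (\<Sum>k<n. (cmod (x k))\<^sup>2)"
proof -
  have prod: "unity_root n (int m * int k) * cnj (unity_root n (int m * int l)) =
      unity_root n (int m * (int k - int l))" for m k l
    by (simp add: unity_root_def cis_cnj cis_mult) (simp add: algebra_simps diff_divide_distrib)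
  have "complex_of_real (\<Sum>m<n. (cmod (\<Sum>k<n. x k * unity_root n (int m * int k)))\<^sup>2) =
      (\<Sum>m<n. \<Sum>k<n. \<Sum>l<n. x k * cnj (x l) * unity_root n (int m * (int k - int l)))"
    by (simp add: complex_norm_square sum_product prod[symmetric] mult_ac del: of_real_power)
  also have "\<dots> = (\<Sum>k<n. \<Sum>l<n. \<Sum>m<n. x k * cnj (x l) * unity_root n (int m * (int k - int l)))"
    by (subst sum.swap, rule sum.cong[OF refl], rule sum.swap)
  also have "\<dots> = (\<Sum>k<n. \<Sum>l<n. if k = l then of_nat n * (x k * cnj (x l)) else 0)"
  proof (intro sum.cong refl)
    fix k l assume kl: "k \<in> {..<n}" "l \<in> {..<n}"
    have "int n dvd int k - int l \<longleftrightarrow> k = l"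
      using kl by (metis cong_iff_dvd_diff cong_int_iff cong_less_modulus_unique_nat cong_refl lessThan_iff)
    then show "(\<Sum>m<n. x k * cnj (x l) * unity_root n (int m * (int k - int l))) =
        (if k = l then of_nat n * (x k * cnj (x l)) else 0)"
      using sum_cis_orthogonal[OF n, of "int k - int l"]
      by (simp add: sum_distrib_left[symmetric] unity_root_def mult_ac del: of_int_mult of_int_diff)
  qed
  also have "\<dots> = complex_of_real (real n * (\<Sum>k<n. (cmod (x k))\<^sup>2))"
    by (simp add: sum.delta' sum_distrib_left complex_norm_square del: of_real_power)
  finally show ?thesis by (simp only: of_real_eq_iff)
qed

text \<open>For \<open>m\<close> prime to \<open>n\<close> all the Gauss sums have the same modulus, so Parseval bounds each of
  them; for other \<open>m\<close> primitivity of the character makes the sum vanish.\<close>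
lemma norm_gauss_sum_le:
  assumes "odd n" "squarefree n" "1 < n"
  shows "cmod (\<Sum>k<n. of_int (jacobi (int k) n) * unity_root n (m * int k)) \<le> sqrt (real n)"
proof -
  define G where "G m = (\<Sum>k<n. of_int (jacobi (int k) n) * unity_root n (m * int k))" for m :: int
  have n: "0 < n" using assms by simp
  \<comment> \<open>Multiplicativity merges the two symbols, and multiplication by the unit
    \<open>u\<close> merely permutes the summation index.\<close>
  have twist: "of_int (jacobi u n) * G (m * u) = G m" if "coprime u (int n)" for u m
  proof -
    have "of_int (jacobi u n) * G (m * u) =
        (\<Sum>k<n. of_int (jacobi (u * int k) n) * unity_root n (m * (u * int k)))"
      by (simp add: G_def sum_distrib_left jacobi_mult[OF assms(1)] mult_ac)
    also have "\<dots> = G m"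
      unfolding G_def
    proof (rule sum_residues_mult[where f = "\<lambda>x. of_int (jacobi x n) * unity_root n (m * x)"])
      show "of_int (jacobi x n) * unity_root n (m * x) = of_int (jacobi y n) * unity_root n (m * y)"
        if "[x = y] (mod int n)" for x y
        using that jacobi_cong unity_root_cong[OF n] by (metis cong_scalar_left)
    qed (use n that in auto)
    finally show ?thesis .
  qed
  have G_cong: "G x = G y" if "[x = y] (mod int n)" for x y
    unfolding G_def by (intro sum.cong refl arg_cong2[where f = "(*)"] unity_root_cong[OF n] cong_scalar_right that)
  show ?thesis
  proof (cases "coprime m (int n)")
    case True
    have eq: "cmod (G u) = cmod (G 1)" if "coprime u (int n)" for u
    proof -
      have "cmod (G 1) = cmod (of_int (jacobi u n)) * cmod (G u)"
        using twist[OF that, of 1] by (metis norm_mult mult_1)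
      also have "cmod (of_int (jacobi u n)) = 1"
        using jacobi_abs[OF n, of u] that by (simp add: norm_of_int)
      finally show ?thesis by simp
    qed
    define U where "U = {k. k < n \<and> coprime (int k) (int n)}"
    have U: "finite U" "1 \<in> U" using assms(3) by (auto simp: U_def)
    \<comment> \<open>Parseval restricted to unit frequencies. The coefficients have modulus 1
      exactly on \<open>U\<close>, so the total energy is \<open>n * card U\<close> and the factor
      \<open>card U\<close> cancels.\<close>
    have "real (card U) * (cmod (G 1))\<^sup>2 = (\<Sum>k\<in>U. (cmod (G 1))\<^sup>2)"
      by simp
    also have "\<dots> = (\<Sum>k\<in>U. (cmod (G (int k)))\<^sup>2)"
      by (intro sum.cong refl) (simp only: U_def mem_Collect_eq eq)
    also have "\<dots> \<le> (\<Sum>k<n. (cmod (G (int k)))\<^sup>2)"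
      by (rule sum_mono2) (auto simp: U_def)
    also have "\<dots> = real n * (\<Sum>k<n. (cmod (of_int (jacobi (int k) n)))\<^sup>2)"
      unfolding G_def by (rule sum_norm_square_dft[OF n])
    also have "(\<Sum>k<n. (cmod (of_int (jacobi (int k) n)))\<^sup>2) = (\<Sum>k<n. if k \<in> U then 1 else 0)"
    proof (intro sum.cong refl)
      fix k assume "k \<in> {..<n}"
      have "\<bar>real_of_int (jacobi (int k) n)\<bar> = of_int (if coprime (int k) (int n) then 1 else 0)"
        by (simp only: jacobi_abs[OF n] of_int_abs[symmetric])
      then show "(cmod (of_int (jacobi (int k) n)))\<^sup>2 = (if k \<in> U then 1 else 0)"
        using \<open>k \<in> {..<n}\<close> by (auto simp: norm_of_int U_def power2_eq_square)
    qed
    also have "\<dots> = real (card U)"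
      by (simp add: sum.If_cases U_def Int_def conj_commute)
    finally have "real (card U) * (cmod (G 1))\<^sup>2 \<le> real (card U) * real n"
      by (simp add: mult.commute)
    then have "(cmod (G 1))\<^sup>2 \<le> real n"
      using U by (metis card_gt_0_iff empty_iff mult_le_cancel_left_pos of_nat_0_less_iff)
    then show ?thesis using eq[OF True] by (simp only: G_def[symmetric] real_le_rsqrt)
  next
    case False
    then obtain u where u: "jacobi u n = -1" "[m * u = m] (mod int n)"
      using jacobi_primitive[OF assms(1,2)] by blast
    have "coprime u (int n)" using u(1) jacobi_eq_0_iff[OF n, of u] by auto
    \<comment> \<open>The twist by \<open>u\<close> flips the sign while \<open>m * u\<close> is
      congruent to \<open>m\<close>.\<close>
    then have "- G m = G m" using twist[of u m] u(1) G_cong[OF u(2)] by simp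
    then have "G m = 0" by simp
    then show ?thesis by (simp add: G_def)
  qed
qed

subsection \<open>Rotated polynomials\<close>

lemma coeff_rotation:
  "Polynomial.coeff (rotation n r A) k =
    (if k < n then Polynomial.coeff A (nat ((int k + \<lfloor>real n * r\<rfloor>) mod int n)) else 0)"
proof -
  have "Polynomial.coeff (rotation n r A) k =
      (\<Sum>i<n. if i = k then Polynomial.coeff A (nat ((int i + \<lfloor>real n * r\<rfloor>) mod int n)) else 0)"
    unfolding rotation_def by (simp add: coeff_sum)
  then show ?thesis by (simp add: sum.delta')
qed

lemma degree_rotation: "0 < n \<Longrightarrow> Polynomial.degree (rotation n r A) < n"
  unfolding rotation_def by (rule degree_lt_sum_monom)

lemma rotation_add: "rotation n r (A + B) = rotation n r A + rotation n r B"
  unfolding rotation_def by (simp add: add_monom[symmetric] sum.distrib)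

lemma coeff_rotation_char_poly:
  assumes "1 < n" "k < n"
  shows "Polynomial.coeff (rotation n r (char_poly n)) k = of_int (jacobi (int k + \<lfloor>real n * r\<rfloor>) n)"
proof -
  define j where "j = nat ((int k + \<lfloor>real n * r\<rfloor>) mod int n)"
  have j: "j < n" using assms by (simp add: j_def nat_less_iff)
  have "Polynomial.coeff (char_poly n) j = (\<Sum>i\<in>{1..n-1}. if i = j then of_int (jacobi (int i) n) else 0)"
    unfolding char_poly_def by (simp add: coeff_sum)
  also have "\<dots> = of_int (jacobi (int j) n)"
  \<comment> \<open>The sum defining \<open>char_poly\<close> starts at 1, which agrees with
    \<open>jacobi 0 n = 0\<close> for \<open>n > 1\<close>.\<close>
  proof (cases "j = 0")
    case True
    then show ?thesis using assms jacobi_eq_0_iff[of n 0] by (simp add: sum.delta')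
  next
    case False
    then show ?thesis using j by (auto simp: sum.delta')
  qed
  also have "jacobi (int j) n = jacobi (int k + \<lfloor>real n * r\<rfloor>) n"
    using assms by (intro jacobi_cong) (simp add: j_def)
  finally show ?thesis using assms by (simp add: coeff_rotation j_def)
qed

lemma coeff_rotation_V_poly:
  assumes "0 < n" "k < n"
  shows "Polynomial.coeff (rotation n r (V_poly n)) k =
    (if coprime (int k + \<lfloor>real n * r\<rfloor>) (int n) then 0 else 1)"
proof -
  define j where "j = nat ((int k + \<lfloor>real n * r\<rfloor>) mod int n)"
  have j: "j < n" using assms by (simp add: j_def nat_less_iff)
  have fin: "finite {i. i \<le> n - 1 \<and> gcd i n > 1}" by simp
  have "Polynomial.coeff (V_poly n) j = (\<Sum>i\<in>{i. i \<le> n - 1 \<and> gcd i n > 1}. if i = j then 1 else 0)"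
    unfolding V_poly_def by (simp add: coeff_sum)
  also have "\<dots> = (if gcd j n > 1 then 1 else 0)"
    using j by (simp add: sum.delta'[OF fin])
  also have "gcd j n > 1 \<longleftrightarrow> \<not> coprime (int j) (int n)"
  proof -
    have "coprime (int j) (int n) \<longleftrightarrow> gcd j n = 1"
      by (metis coprime_iff_gcd_eq_1 coprime_int_iff)
    moreover have "0 < gcd j n" using assms by simp
    ultimately show ?thesis by linarith
  qed
  also have "coprime (int j) (int n) \<longleftrightarrow> coprime (int k + \<lfloor>real n * r\<rfloor>) (int n)"
  proof -
    have "[int j = int k + \<lfloor>real n * r\<rfloor>] (mod int n)" using assms by (simp add: j_def)
    then show ?thesis using cong_imp_coprime cong_sym by blast
  qed
  finally show ?thesis using assms by (simp add: coeff_rotation j_def)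
qed

text \<open>This is \<open>n - totient n\<close>: the number of zero coefficients of the character
  polynomial and of ones in \<open>V_poly n\<close>, unchanged under rotation.\<close>

definition noncoprime_count :: "nat \<Rightarrow> nat" where
  "noncoprime_count n = card {k. k < n \<and> \<not> coprime (int k) (int n)}"

lemma sum_coprime_shift:
  assumes "0 < n"
  shows "(\<Sum>k<n. if coprime (int k + s) (int n) then 0 else 1 :: real) = real (noncoprime_count n)"
proof -
  have "(\<Sum>k<n. if coprime (int k + s) (int n) then 0 else 1 :: real) =
      (\<Sum>k<n. if coprime (int k) (int n) then 0 else 1)"
  proof (rule sum_residues_shift[where f = "\<lambda>x. if coprime x (int n) then 0 else 1"])
    show "(if coprime x (int n) then 0 else 1) = (if coprime y (int n) then 0 else (1::real))"
      if "[x = y] (mod int n)" for x y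
      using cong_imp_coprime[OF that] cong_imp_coprime[OF cong_sym[OF that]] by auto
  qed (use assms in auto)
  also have "\<dots> = real (noncoprime_count n)"
    by (simp add: sum.If_cases noncoprime_count_def Int_def conj_commute)
  finally show ?thesis .
qed

lemma noncoprime_count_less: "1 < n \<Longrightarrow> noncoprime_count n < n"
proof -
  assume "1 < n"
  then have "{k. k < n \<and> \<not> coprime (int k) (int n)} \<subset> {..<n}"
  proof (intro psubsetI)
    have "1 \<in> {..<n}" "1 \<notin> {k. k < n \<and> \<not> coprime (int k) (int n)}" using \<open>1 < n\<close> by auto
    then show "{k. k < n \<and> \<not> coprime (int k) (int n)} \<noteq> {..<n}" by metis
  qed auto
  then show ?thesis
    unfolding noncoprime_count_def using psubset_card_mono[of "{..<n}"] by simp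
qed

text \<open>Each prime factor contributes at least a factor 2 to \<open>n\<close>, so 2 to the
  number of prime factors is at most \<open>n\<close>; the constant 2 comes from
  \<open>ln 2 \<ge> 1/2\<close>.\<close>

lemma card_prime_factors_le:
  assumes "1 < n"
  shows "real (card (prime_factors n)) \<le> 2 * ln (real n)"
proof -
  have "2 ^ card (prime_factors n) = (\<Prod>p\<in>prime_factors n. 2::nat)" by simp
  also have "\<dots> \<le> (\<Prod>p\<in>prime_factors n. p ^ multiplicity p n)"
  proof (rule prod_mono)
    fix p assume p: "p \<in> prime_factors n"
    then have "2 \<le> p" "0 < multiplicity p n"
      using prime_ge_2_nat by (auto simp: prime_factors_multiplicity)
    then have "p ^ 1 \<le> p ^ multiplicity p n" by (intro power_increasing) auto
    with \<open>2 \<le> p\<close> show "0 \<le> (2::nat) \<and> 2 \<le> p ^ multiplicity p n" by simp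
  qed
  also have "\<dots> = n"
    using prod_prime_factors[of n] assms by simp
  finally have "2 ^ card (prime_factors n) \<le> real n"
    by (metis of_nat_le_iff of_nat_numeral of_nat_power)
  then have "ln (2 ^ card (prime_factors n)) \<le> ln (real n)"
    by (subst ln_le_cancel_iff) (use assms in auto)
  then have "real (card (prime_factors n)) * ln 2 \<le> ln (real n)"
    by (simp add: ln_realpow)
  moreover have "real (card (prime_factors n)) * (1/2) \<le> real (card (prime_factors n)) * ln 2"
    using ln2_ge_two_thirds by (intro mult_left_mono) auto
  ultimately show ?thesis by linarith
qed

lemma smallest_prime_factor:
  assumes "1 < n"
  shows "prime (smallest_prime_factor n)" "smallest_prime_factor n dvd n"
    "\<And>q. q \<in> prime_factors n \<Longrightarrow> smallest_prime_factor n \<le> q"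
proof -
  have ne: "prime_factors n \<noteq> {}" using assms prime_factor_nat[of n] by (auto simp: prime_factors_dvd)
  have "smallest_prime_factor n \<in> prime_factors n"
    unfolding smallest_prime_factor_def by (rule Min_in) (use ne in auto)
  then show "prime (smallest_prime_factor n)" "smallest_prime_factor n dvd n" by auto
  show "smallest_prime_factor n \<le> q" if "q \<in> prime_factors n" for q
    unfolding smallest_prime_factor_def using that by simp
qed

text \<open>Union bound: the residues in question are multiples of some prime factor
  \<open>q\<close>, each \<open>q\<close> accounts for at most \<open>n / q \<le> n / p\<close> of
  them, and there are at most \<open>2 * ln n\<close> such primes.\<close>

lemma noncoprime_count_le:
  assumes "1 < n"
  shows "real (noncoprime_count n) \<le> 2 * ln (real n) * (real n / real (smallest_prime_factor n))"
proof -
  define p where "p = smallest_prime_factor n"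
  note spf = smallest_prime_factor[OF assms, folded p_def]
  have p0: "0 < p" using spf(1) prime_gt_0_nat by blast
  have sub: "{k. k < n \<and> \<not> coprime (int k) (int n)} \<subseteq>
      (\<Union>q\<in>prime_factors n. (\<lambda>t. q * t) ` {..<n div q})"
  proof
    fix k assume "k \<in> {k. k < n \<and> \<not> coprime (int k) (int n)}"
    then have k: "k < n" "gcd k n \<noteq> 1" by (auto simp only: mem_Collect_eq coprime_int_iff coprime_iff_gcd_eq_1[of k n])
    then obtain q where q: "prime q" "q dvd k" "q dvd n" using prime_factor_nat by (meson gcd_nat.bounded_iff)
    then obtain t where t: "k = q * t" by auto
    have "t < n div q"
      using q k(1) t by (metis dvd_mult_div_cancel mult_less_cancel1)
    moreover have "q \<in> prime_factors n" using q assms by (simp add: prime_factors_dvd)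
    ultimately show "k \<in> (\<Union>q\<in>prime_factors n. (\<lambda>t. q * t) ` {..<n div q})" using t by auto
  qed
  have "noncoprime_count n \<le> card (\<Union>q\<in>prime_factors n. (\<lambda>t. q * t) ` {..<n div q})"
    unfolding noncoprime_count_def by (rule card_mono[OF _ sub]) auto
  also have "\<dots> \<le> (\<Sum>q\<in>prime_factors n. card ((\<lambda>t. q * t) ` {..<n div q}))"
    by (rule card_UN_le) auto
  finally have "real (noncoprime_count n) \<le> (\<Sum>q\<in>prime_factors n. real (card ((\<lambda>t. q * t) ` {..<n div q})))"
    by (metis of_nat_le_iff of_nat_sum)
  also have "\<dots> \<le> (\<Sum>q\<in>prime_factors n. real n / real p)"
  proof (rule sum_mono)
    fix q assume "q \<in> prime_factors n"
    then have "p \<le> q" by (rule spf)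
    have "card ((\<lambda>t. q * t) ` {..<n div q}) \<le> n div q"
      using card_image_le[of "{..<n div q}" "\<lambda>t. q * t"] by simp
    then have "real (card ((\<lambda>t. q * t) ` {..<n div q})) \<le> real n / real q"
      by (meson of_nat_mono order_trans of_nat_div_le_of_nat)
    also have "\<dots> \<le> real n / real p"
      using \<open>p \<le> q\<close> p0 by (intro divide_left_mono) auto
    finally show "real (card ((\<lambda>t. q * t) ` {..<n div q})) \<le> real n / real p" .
  qed
  also have "\<dots> = real (card (prime_factors n)) * (real n / real p)" by simp
  also have "\<dots> \<le> 2 * ln (real n) * (real n / real p)"
    by (intro mult_right_mono card_prime_factors_le assms) auto
  finally show ?thesis by (simp add: p_def)
qed

subsection \<open>Lower bounds for the merit factor\<close>

text \<open>Reverse triangle inequality raised to the fourth power, with the nonnegative middle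
  binomial term dropped.\<close>

lemma fourth_power_norm_add_ge:
  fixes x y :: "'a::real_normed_vector"
  shows "norm x ^ 4 + norm y ^ 4 - 4 * norm x ^ 3 * norm y - 4 * norm x * norm y ^ 3 \<le> norm (x + y) ^ 4"
proof -
  have "(norm x - norm y) ^ 4 = norm x ^ 4 + norm y ^ 4 - 4 * norm x ^ 3 * norm y - 4 * norm x * norm y ^ 3
      + 6 * (norm x * norm y)\<^sup>2"
    by (simp add: power4_eq_xxxx power3_eq_cube power2_eq_square algebra_simps)
  moreover have "(norm x - norm y) ^ 4 \<le> norm (x + y) ^ 4"
    using norm_triangle_ineq3[of x "- y"] by (intro power_mono_even) auto
  moreover have "0 \<le> 6 * (norm x * norm y)\<^sup>2" by simp
  ultimately show ?thesis by linarith
qed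

section \<open>Second moments and pointwise bounds of the rotated polynomials\<close>

lemma circle_mean_norm_rotation_char_poly:
  assumes "1 < n"
  shows "circle_mean (\<lambda>z. (cmod (poly (rotation n r (char_poly n)) z))\<^sup>2) = real n - real (noncoprime_count n)"
proof -
  have "circle_mean (\<lambda>z. (cmod (poly (rotation n r (char_poly n)) z))\<^sup>2) =
      (\<Sum>k<n. (cmod (Polynomial.coeff (rotation n r (char_poly n)) k))\<^sup>2)"
    by (rule circle_mean_norm_square) (use assms degree_rotation in auto)
  also have "\<dots> = (\<Sum>k<n. 1 - (if coprime (int k + \<lfloor>real n * r\<rfloor>) (int n) then 0 else 1))"
  proof (intro sum.cong refl)
    fix k assume "k \<in> {..<n}"
    moreover have "\<bar>real_of_int (jacobi x n)\<bar> = of_int (if coprime x (int n) then 1 else 0)" for x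
      using assms by (simp only: jacobi_abs of_int_abs[symmetric])
    ultimately show "(cmod (Polynomial.coeff (rotation n r (char_poly n)) k))\<^sup>2 =
        1 - (if coprime (int k + \<lfloor>real n * r\<rfloor>) (int n) then 0 else 1)"
      using assms by (simp add: coeff_rotation_char_poly norm_of_int)
  qed
  also have "\<dots> = real n - real (noncoprime_count n)"
    using assms by (simp add: sum_subtractf sum_coprime_shift)
  finally show ?thesis .
qed

lemma circle_mean_norm_rotation_V_poly:
  assumes "0 < n"
  shows "circle_mean (\<lambda>z. (cmod (poly (rotation n r (V_poly n)) z))\<^sup>2) = real (noncoprime_count n)"
proof -
  have "circle_mean (\<lambda>z. (cmod (poly (rotation n r (V_poly n)) z))\<^sup>2) =
      (\<Sum>k<n. (cmod (Polynomial.coeff (rotation n r (V_poly n)) k))\<^sup>2)"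
    by (rule circle_mean_norm_square) (use assms degree_rotation in auto)
  also have "\<dots> = (\<Sum>k<n. (if coprime (int k + \<lfloor>real n * r\<rfloor>) (int n) then 0 else 1))"
    by (intro sum.cong refl) (use assms in \<open>simp add: coeff_rotation_V_poly\<close>)
  also have "\<dots> = real (noncoprime_count n)"
    using assms by (simp add: sum_coprime_shift)
  finally show ?thesis .
qed

text \<open>The ones of \<open>V_poly\<close> fill exactly the zeros of the character polynomial, so
  every coefficient of the sum is 1 or -1.\<close>

lemma circle_mean_norm_rotation_sum:
  assumes "1 < n"
  shows "circle_mean (\<lambda>z. (cmod (poly (rotation n r (char_poly n + V_poly n)) z))\<^sup>2) = real n"
proof -
  have "circle_mean (\<lambda>z. (cmod (poly (rotation n r (char_poly n + V_poly n)) z))\<^sup>2) =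
      (\<Sum>k<n. (cmod (Polynomial.coeff (rotation n r (char_poly n + V_poly n)) k))\<^sup>2)"
    by (rule circle_mean_norm_square) (use assms degree_rotation in auto)
  also have "\<dots> = (\<Sum>k<n. 1)"
  proof (intro sum.cong refl)
    fix k assume k: "k \<in> {..<n}"
    let ?x = "int k + \<lfloor>real n * r\<rfloor>"
    have "\<bar>jacobi ?x n\<bar> = (if coprime ?x (int n) then 1 else 0)"
      using assms by (intro jacobi_abs) simp
    then have "jacobi ?x n = (if coprime ?x (int n) then 1 else 0) \<or>
        jacobi ?x n = (if coprime ?x (int n) then -1 else 0)" by (auto split: if_splits)
    then show "(cmod (Polynomial.coeff (rotation n r (char_poly n + V_poly n)) k))\<^sup>2 = 1"
      using assms k
      by (auto simp: rotation_add coeff_rotation_char_poly coeff_rotation_V_poly split: if_splits)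
  qed
  finally show ?thesis by simp
qed

text \<open>At an \<open>n\<close>-th root of unity the value is a Gauss sum up to a unimodular
  factor caused by the shift; interpolation extends the bound to the whole circle.\<close>

lemma norm_rotation_char_poly_le:
  assumes "odd n" "squarefree n" "1 < n" "cmod z = 1"
  shows "cmod (poly (rotation n r (char_poly n)) z) \<le> sqrt (real n) * (3 + ln (real n))"
proof (rule norm_poly_le_of_roots_of_unity)
  fix m :: int
  let ?s = "\<lfloor>real n * r\<rfloor>"
  have n: "0 < n" using assms by simp
  let ?f = "\<lambda>x. of_int (jacobi x n) * unity_root n (m * x)"
  have pow: "unity_root n m ^ k = unity_root n (m * (int k + ?s)) * unity_root n (- (m * ?s))" for k
    by (simp add: unity_root_def cis_mult Complex.DeMoivre) (simp add: field_simps add_divide_distrib)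
  have "poly (rotation n r (char_poly n)) (unity_root n m) =
      (\<Sum>k<n. Polynomial.coeff (rotation n r (char_poly n)) k * unity_root n m ^ k)"
    by (rule poly_eq_sum_lessThan) (rule degree_rotation[OF n])
  also have "\<dots> = (\<Sum>k<n. ?f (int k + ?s)) * unity_root n (- (m * ?s))"
    unfolding sum_distrib_right
    by (intro sum.cong refl) (use assms(3) in \<open>simp add: coeff_rotation_char_poly pow mult.assoc\<close>)
  also have "(\<Sum>k<n. ?f (int k + ?s)) = (\<Sum>k<n. ?f (int k))"
  proof (rule sum_residues_shift[OF n])
    show "?f x = ?f y" if "[x = y] (mod int n)" for x y
      using jacobi_cong[OF that] unity_root_cong[OF n cong_scalar_left[OF that]] by simp
  qed
  finally have "cmod (poly (rotation n r (char_poly n)) (unity_root n m)) = cmod (\<Sum>k<n. ?f (int k))"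
    by (simp add: norm_mult)
  then show "cmod (poly (rotation n r (char_poly n)) (cis (2 * pi * of_int m / real n))) \<le> sqrt (real n)"
    using norm_gauss_sum_le[OF assms(1-3), of m] by (simp add: unity_root_def)
qed (use assms degree_rotation in auto)

lemma norm_rotation_V_poly_le:
  assumes "0 < n" "cmod z = 1"
  shows "cmod (poly (rotation n r (V_poly n)) z) \<le> real (noncoprime_count n)"
proof -
  have "cmod (poly (rotation n r (V_poly n)) z) =
      cmod (\<Sum>k<n. Polynomial.coeff (rotation n r (V_poly n)) k * z ^ k)"
    using assms by (subst poly_eq_sum_lessThan[OF degree_rotation]) auto
  also have "\<dots> \<le> (\<Sum>k<n. cmod (Polynomial.coeff (rotation n r (V_poly n)) k * z ^ k))"
    by (rule norm_sum)
  also have "\<dots> = (\<Sum>k<n. if coprime (int k + \<lfloor>real n * r\<rfloor>) (int n) then 0 else 1)"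
    by (intro sum.cong refl) (use assms in \<open>simp add: coeff_rotation_V_poly norm_mult norm_power\<close>)
  finally show ?thesis using assms by (simp add: sum_coprime_shift)
qed

section \<open>Fourth moments and merit factors of the rotated polynomials\<close>

lemma rotation_residue_class_moment:
  assumes "1 < n" and p: "prime p" "p dvd n"
    and one: "\<And>k. k < n \<Longrightarrow> \<not> coprime (int k + \<lfloor>real n * r\<rfloor>) (int n) \<Longrightarrow>
      Polynomial.coeff (rotation n r A) k = 1"
  shows "(real n / real p) ^ 3 / 2 \<le> circle_mean (\<lambda>z. cmod (poly (rotation n r A) z) ^ 4)"
proof -
  let ?s = "\<lfloor>real n * r\<rfloor>"
  obtain N where N: "n = p * N" using p(2) by auto
  have pos: "0 < p" "0 < N" using assms(1) N by (auto intro: Nat.gr0I)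
  \<comment> \<open>Index \<open>j\<close> of the rotation carries the residue
    \<open>j + ?s\<close>, so the multiples of \<open>p\<close> sit at the indices in the class of
    \<open>- ?s\<close>.\<close>
  define a where "a = nat ((- ?s) mod int p)"
  have "real N ^ 3 / 2 \<le> circle_mean (\<lambda>z. cmod (poly (rotation n r A) z) ^ 4)"
  proof (rule fourth_moment_ge_residue_class)
    show "a < p" using pos by (simp add: a_def nat_less_iff)
    show "Polynomial.degree (rotation n r A) < p * N"
      using degree_rotation[of n r A] assms(1) N by (simp only: pos mult_pos_pos)
    fix j assume j: "j < p * N" "j mod p = a"
    have "int j mod int p = (- ?s) mod int p"
      using j(2) pos by (simp add: a_def zmod_int[symmetric] flip: of_nat_mod)
    then have "int p dvd int j + ?s" by (simp add: mod_eq_dvd_iff)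
    moreover have "int p dvd int n" using p by simp
    ultimately have "\<not> coprime (int j + ?s) (int n)"
      using p(1) by (metis coprime_common_divisor not_prime_unit prime_int_nat_transfer prime_nat_int_transfer)
    then show "Polynomial.coeff (rotation n r A) j = 1" using j(1) N by (intro one) auto
  qed (use pos in auto)
  moreover have "real n / real p = real N" using N pos by simp
  ultimately show ?thesis by simp
qed

lemma coeff_rotation_sum_noncoprime:
  assumes "1 < n" "k < n" "\<not> coprime (int k + \<lfloor>real n * r\<rfloor>) (int n)"
  shows "Polynomial.coeff (rotation n r (char_poly n + V_poly n)) k = 1"
  using assms jacobi_eq_0_iff[of n "int k + \<lfloor>real n * r\<rfloor>"]
  by (simp add: rotation_add coeff_rotation_char_poly coeff_rotation_V_poly)

lemma inverse_merit_factor_rotation_sum: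
  assumes "1 < n"
  shows "1 / merit_factor (rotation n r (char_poly n + V_poly n)) =
    circle_mean (\<lambda>z. cmod (poly (rotation n r (char_poly n + V_poly n)) z) ^ 4) / (real n)\<^sup>2 - 1"
  using assms by (subst inverse_merit_factor) (simp_all add: circle_mean_norm_rotation_sum)

lemma inverse_merit_factor_rotation_char_poly:
  assumes "1 < n"
  shows "1 / merit_factor (rotation n r (char_poly n)) =
    circle_mean (\<lambda>z. cmod (poly (rotation n r (char_poly n)) z) ^ 4) /
      (real n - real (noncoprime_count n))\<^sup>2 - 1"
  using assms noncoprime_count_less[OF assms]
  by (subst inverse_merit_factor) (simp_all add: circle_mean_norm_rotation_char_poly)

text \<open>Intended for small \<open>p\<close>: nothing is assumed about the interference of the
  two polynomials, and the loss of 1 is harmless because the main term is then large.\<close>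

lemma inverse_merit_factor_sum_ge:
  assumes "1 < n"
  shows "real n / (2 * real (smallest_prime_factor n) ^ 3) - 1
    \<le> 1 / merit_factor (rotation n r (char_poly n + V_poly n))"
proof -
  let ?p = "smallest_prime_factor n"
  have "(real n / real ?p) ^ 3 / 2 \<le>
      circle_mean (\<lambda>z. cmod (poly (rotation n r (char_poly n + V_poly n)) z) ^ 4)"
    using assms smallest_prime_factor[OF assms] coeff_rotation_sum_noncoprime
    by (intro rotation_residue_class_moment) auto
  then have "(real n / real ?p) ^ 3 / 2 / (real n)\<^sup>2 \<le>
      circle_mean (\<lambda>z. cmod (poly (rotation n r (char_poly n + V_poly n)) z) ^ 4) / (real n)\<^sup>2"
    by (rule divide_right_mono) simp
  moreover have "(real n / real ?p) ^ 3 / 2 / (real n)\<^sup>2 = real n / (2 * real ?p ^ 3)"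
    using assms by (simp add: power_divide power3_eq_cube power2_eq_square)
  ultimately show ?thesis
    by (simp add: inverse_merit_factor_rotation_sum[OF assms])
qed

text \<open>Integrate \<open>2 * m * f \<le> m^2 + f^2\<close> with \<open>m\<close> the mean of
  \<open>f\<close>.\<close>

lemma circle_mean_square_le:
  assumes "continuous_on UNIV f"
  shows "(circle_mean f)\<^sup>2 \<le> circle_mean (\<lambda>z. (f z)\<^sup>2)"
proof -
  let ?m = "circle_mean f"
  have "circle_mean (\<lambda>z. 2 * ?m * f z) \<le> circle_mean (\<lambda>z. ?m\<^sup>2 + (f z)\<^sup>2)"
    by (rule circle_mean_mono) (auto intro!: continuous_intros assms sum_squares_bound)
  also have "\<dots> = ?m\<^sup>2 + circle_mean (\<lambda>z. (f z)\<^sup>2)"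
    using assms by (subst circle_mean_add) (auto intro!: continuous_intros simp only: circle_mean_const)
  finally show ?thesis
    by (simp add: circle_mean_cmult power2_eq_square)
qed

text \<open>The fourth moment dominates the square of the second. Nonnegativity is what later allows
  limits inferior to be added in the extended reals.\<close>

lemma inverse_merit_factor_nonneg:
  assumes "1 < n"
  shows "0 \<le> 1 / merit_factor (rotation n r (char_poly n))"
proof -
  have "(real n - real (noncoprime_count n))\<^sup>2 \<le>
      circle_mean (\<lambda>z. ((cmod (poly (rotation n r (char_poly n)) z))\<^sup>2)\<^sup>2)"
    unfolding circle_mean_norm_rotation_char_poly[OF assms, of r, symmetric]
    by (intro circle_mean_square_le continuous_intros)
  then show ?thesis
    using noncoprime_count_less[OF assms]
    by (simp add: inverse_merit_factor_rotation_char_poly[OF assms] field_simps)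
qed

text \<open>The mixed terms are bounded by \<open>M^3\<close> times the mean of |Y|, at most
  \<open>sqrt W\<close>, and by \<open>M * W\<close> times the mean of |Y|^2, equal to
  \<open>W\<close>. The factor \<open>(1 - W / n)^2\<close> converts the normalisation
  \<open>(n - W)^2\<close> belonging to X into the \<open>n^2\<close> belonging to X + Y.\<close>

lemma inverse_merit_factor_sum_ge_perturbed:
  fixes n :: nat and r :: real
  assumes "odd n" "squarefree n" "1 < n"
  defines "W \<equiv> real (noncoprime_count n)" and "M \<equiv> sqrt (real n) * (3 + ln (real n))"
  shows "(1 / merit_factor (rotation n r (char_poly n)) + 1) * (1 - W / real n)\<^sup>2
      + real n / (2 * real (smallest_prime_factor n) ^ 3) - 1
      - (4 * M ^ 3 * sqrt W + 4 * M * W\<^sup>2) / (real n)\<^sup>2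
    \<le> 1 / merit_factor (rotation n r (char_poly n + V_poly n))"
proof -
  let ?p = "smallest_prime_factor n"
  define X where "X z = poly (rotation n r (char_poly n)) z" for z
  define Y where "Y z = poly (rotation n r (V_poly n)) z" for z
  have cont: "continuous_on UNIV X" "continuous_on UNIV Y"
    unfolding X_def Y_def by (intro continuous_intros)+
  have M: "cmod (X z) \<le> M" if "cmod z = 1" for z
    unfolding X_def M_def using assms(1-3) that by (rule norm_rotation_char_poly_le)
  have "0 \<le> M" using M[of 1] by (metis norm_ge_zero norm_one order_trans)
  have W: "cmod (Y z) \<le> W" if "cmod z = 1" for z
    unfolding Y_def W_def using assms(3) that by (intro norm_rotation_V_poly_le) auto
  have W0: "W < real n"
    using noncoprime_count_less assms(3) by (auto simp: W_def)
  have Y2: "circle_mean (\<lambda>z. (cmod (Y z))\<^sup>2) = W"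
    unfolding Y_def W_def using assms(3) by (intro circle_mean_norm_rotation_V_poly) auto
  have Y1: "circle_mean (\<lambda>z. cmod (Y z)) \<le> sqrt W"
    using circle_mean_square_le[of "\<lambda>z. cmod (Y z)"] cont Y2
    by (intro real_le_rsqrt) (auto intro: continuous_intros)
  have Y4: "(real n / real ?p) ^ 3 / 2 \<le> circle_mean (\<lambda>z. cmod (Y z) ^ 4)"
    unfolding Y_def using assms(3) smallest_prime_factor[OF assms(3)]
    by (intro rotation_residue_class_moment) (auto simp: coeff_rotation_V_poly)
  have "circle_mean (\<lambda>z. cmod (X z) ^ 4) + circle_mean (\<lambda>z. cmod (Y z) ^ 4)
      + ((- 4 * M ^ 3) * circle_mean (\<lambda>z. cmod (Y z)) + (- 4 * M * W) * circle_mean (\<lambda>z. (cmod (Y z))\<^sup>2)) =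
      circle_mean (\<lambda>z. (cmod (X z) ^ 4 + cmod (Y z) ^ 4) + ((- 4 * M ^ 3) * cmod (Y z) + (- 4 * M * W) * (cmod (Y z))\<^sup>2))"
    by (subst circle_mean_add, (intro continuous_intros cont)+)+ (simp only: circle_mean_cmult)
  also have "\<dots> \<le> circle_mean (\<lambda>z. cmod (X z + Y z) ^ 4)"
  proof (rule circle_mean_mono)
    fix z :: complex assume z: "cmod z = 1"
    have "4 * cmod (X z) ^ 3 * cmod (Y z) \<le> 4 * M ^ 3 * cmod (Y z)"
      using M[OF z] by (intro mult_right_mono mult_left_mono power_mono) auto
    moreover have "4 * cmod (X z) * cmod (Y z) ^ 3 \<le> 4 * M * W * (cmod (Y z))\<^sup>2"
    proof -
      have "4 * cmod (X z) * cmod (Y z) ^ 3 = 4 * (cmod (X z) * cmod (Y z)) * (cmod (Y z))\<^sup>2"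
        by (simp add: power3_eq_cube power2_eq_square)
      also have "\<dots> \<le> 4 * (M * W) * (cmod (Y z))\<^sup>2"
        using M[OF z] W[OF z] \<open>0 \<le> M\<close> by (intro mult_right_mono mult_left_mono mult_mono) auto
      finally show ?thesis by (simp add: mult.assoc)
    qed
    ultimately show "(cmod (X z) ^ 4 + cmod (Y z) ^ 4)
        + ((- 4 * M ^ 3) * cmod (Y z) + (- 4 * M * W) * (cmod (Y z))\<^sup>2) \<le> cmod (X z + Y z) ^ 4"
      using fourth_power_norm_add_ge[of "X z" "Y z"] by (simp add: mult.assoc)
  qed (intro continuous_intros cont)+
  finally have "circle_mean (\<lambda>z. cmod (X z) ^ 4) + circle_mean (\<lambda>z. cmod (Y z) ^ 4)
      - 4 * M ^ 3 * circle_mean (\<lambda>z. cmod (Y z)) - 4 * M * W * W \<le> circle_mean (\<lambda>z. cmod (X z + Y z) ^ 4)"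
    by (simp add: Y2)
  moreover have "4 * M ^ 3 * circle_mean (\<lambda>z. cmod (Y z)) \<le> 4 * M ^ 3 * sqrt W"
    using Y1 \<open>0 \<le> M\<close> by (intro mult_left_mono) auto
  ultimately have main: "circle_mean (\<lambda>z. cmod (X z) ^ 4) + (real n / real ?p) ^ 3 / 2
      - (4 * M ^ 3 * sqrt W + 4 * M * W\<^sup>2) \<le> circle_mean (\<lambda>z. cmod (X z + Y z) ^ 4)"
    using Y4 by (simp add: power2_eq_square)
  have "1 / merit_factor (rotation n r (char_poly n + V_poly n)) =
      circle_mean (\<lambda>z. cmod (X z + Y z) ^ 4) / (real n)\<^sup>2 - 1"
    by (simp only: inverse_merit_factor_rotation_sum[OF assms(3)])
       (simp add: rotation_add X_def Y_def)
  moreover have "(circle_mean (\<lambda>z. cmod (X z) ^ 4) + (real n / real ?p) ^ 3 / 2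
      - (4 * M ^ 3 * sqrt W + 4 * M * W\<^sup>2)) / (real n)\<^sup>2
      \<le> circle_mean (\<lambda>z. cmod (X z + Y z) ^ 4) / (real n)\<^sup>2"
    using main by (rule divide_right_mono) simp
  moreover have "circle_mean (\<lambda>z. cmod (X z) ^ 4) / (real n)\<^sup>2 =
      (1 / merit_factor (rotation n r (char_poly n)) + 1) * (1 - W / real n)\<^sup>2"
  proof -
    have "(1 - W / real n)\<^sup>2 = (real n - W)\<^sup>2 / (real n)\<^sup>2"
      using assms(3) by (simp add: diff_divide_distrib flip: power_divide)
    then show ?thesis
      using W0 by (simp add: inverse_merit_factor_rotation_char_poly[OF assms(3)] X_def W_def)
  qed
  moreover have "(real n / real ?p) ^ 3 / 2 / (real n)\<^sup>2 = real n / (2 * real ?p ^ 3)"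
    using assms(3) by (simp add: power_divide power3_eq_cube power2_eq_square)
  ultimately show ?thesis
    by (simp only: add_divide_distrib diff_divide_distrib)
qed

section \<open>Passage to the limit inferior\<close>

lemma noncoprime_count_powr_le:
  assumes "1 < n" "real n powr 0.33 \<le> real (smallest_prime_factor n)"
  shows "real (noncoprime_count n) \<le> 2 * ln (real n) * real n powr 0.67"
proof -
  have "real n / real (smallest_prime_factor n) \<le> real n / real n powr 0.33"
    using assms prime_gt_0_nat[OF smallest_prime_factor(1)[OF assms(1)]]
    by (intro divide_left_mono mult_pos_pos) auto
  also have "\<dots> = real n powr 0.67"
    using powr_diff[of "real n" 1 "0.33"] assms(1) by simp
  finally have "2 * ln (real n) * (real n / real (smallest_prime_factor n)) \<le> 2 * ln (real n) * real n powr 0.67"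
    using assms(1) by (intro mult_left_mono) auto
  with noncoprime_count_le[OF assms(1)] show ?thesis by linarith
qed

theorem theorem3:
  fixes S :: "nat set" and r :: real
  assumes "infinite S"
    and "\<And>n. n \<in> S \<Longrightarrow> odd n \<and> squarefree n \<and> n > 1"
  shows "Liminf (inf at_top (principal S))
            (\<lambda>n. ereal (1 / merit_factor (rotation n r (char_poly n + V_poly n))))
         \<ge> Liminf (inf at_top (principal S))
              (\<lambda>n. ereal (1 / merit_factor (rotation n r (char_poly n))))
           + Liminf (inf at_top (principal S))
              (\<lambda>n. ereal (real n / (2 * real (smallest_prime_factor n) ^ 3)))"
proof -
  define F where "F = inf at_top (principal S)"
  define a where "a n = 1 / merit_factor (rotation n r (char_poly n + V_poly n))" for n
  define b where "b n = 1 / merit_factor (rotation n r (char_poly n))" for n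
  define c where "c n = real n / (2 * real (smallest_prime_factor n) ^ 3)" for n
  have ev_F: "eventually P F \<longleftrightarrow> (\<forall>\<^sub>F n in at_top. n \<in> S \<longrightarrow> P n)" for P
    by (simp add: F_def eventually_inf_principal)
  have "F \<noteq> bot"
  proof
    assume "F = bot"
    then have "\<forall>\<^sub>F n in at_top. n \<notin> S" using ev_F[of "\<lambda>_. False"] by simp
    then obtain N where "\<And>n. n \<ge> N \<Longrightarrow> n \<notin> S" by (auto simp: eventually_at_top_linorder)
    then have "S \<subseteq> {..<N}" by (meson lessThan_iff not_le subsetI)
    with assms(1) show False using finite_subset by blast
  qed
  have "Liminf F (\<lambda>n. ereal (b n)) + Liminf F (\<lambda>n. ereal (c n)) \<le> Liminf F (\<lambda>n. ereal (b n) + ereal (c n))"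
  proof (rule Liminf_add_le[OF \<open>F \<noteq> bot\<close>])
    show "\<forall>\<^sub>F n in F. 0 \<le> ereal (b n)"
      unfolding ev_F b_def using assms(2) inverse_merit_factor_nonneg by (intro always_eventually) auto
    show "\<forall>\<^sub>F n in F. 0 \<le> ereal (c n)" by (simp add: c_def)
  qed
  also have "\<dots> \<le> Liminf F (\<lambda>n. ereal (a n))"
    unfolding le_Liminf_iff
  proof (intro allI impI)
    fix y assume "y < Liminf F (\<lambda>n. ereal (b n) + ereal (c n))"
    \<comment> \<open>Two reals are inserted above \<open>y\<close>: eventually
      \<open>b n + c n\<close> exceeds \<open>x\<close>, and the gap between \<open>w\<close> and
      \<open>x\<close> leaves room for the vanishing errors.\<close>
    then obtain x where x: "y < ereal x" "ereal x < Liminf F (\<lambda>n. ereal (b n) + ereal (c n))"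
      using ereal_dense2 by blast
    then obtain w where w: "y < ereal w" "w < x"
      using ereal_dense2[OF x(1)] by auto
    have bc: "\<forall>\<^sub>F n in F. x < b n + c n"
      using less_LiminfD[OF x(2)] by simp
    define W where "W n = 2 * ln (real n) * real n powr 0.67" for n :: nat
    define M where "M n = sqrt (real n) * (3 + ln (real n))" for n :: nat
    \<comment> \<open>The factor 2 comes from \<open>(1 - t)^2 \<ge> 1 - 2 * t\<close> with
      \<open>t = W' / n\<close>.\<close>
    define \<delta> where "\<delta> n = 2 * W n / real n" for n
    define \<epsilon> where "\<epsilon> n = (4 * M n ^ 3 * sqrt (W n) + 4 * M n * (W n)\<^sup>2) / (real n)\<^sup>2" for n
    have lim\<delta>: "\<delta> \<longlonglongrightarrow> 0" unfolding \<delta>_def W_def by real_asymp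
    \<comment> \<open>Up to logarithms the two terms have orders n^(-0.165) and n^(-0.16).\<close>
    have lim\<epsilon>: "\<epsilon> \<longlonglongrightarrow> 0" unfolding \<epsilon>_def W_def M_def by real_asymp
    have "(\<lambda>n. (x + 1) * (1 - \<delta> n) - 1 - \<epsilon> n) \<longlonglongrightarrow> (x + 1) * (1 - 0) - 1 - 0"
      by (intro tendsto_intros lim\<delta> lim\<epsilon>)
    then have ev1: "\<forall>\<^sub>F n in at_top. w < (x + 1) * (1 - \<delta> n) - 1 - \<epsilon> n"
      using w(2) by (intro order_tendstoD(1)) auto
    have ev2: "\<forall>\<^sub>F n in at_top. \<delta> n < 1"
      using lim\<delta> by (rule order_tendstoD) simp
    have "filterlim (\<lambda>n::nat. real n powr 0.01 / 2 - 1) at_top at_top" by real_asymp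
    then have ev3: "\<forall>\<^sub>F n in at_top. w < real n powr 0.01 / 2 - 1"
      by (simp add: filterlim_at_top_dense)
    have "\<forall>\<^sub>F n in F. w < a n"
      unfolding ev_F using bc[unfolded ev_F] ev1 ev2 ev3
    proof eventually_elim
      case (elim n)
      show ?case
      proof
        assume "n \<in> S"
        with elim(1) have xbc: "x < b n + c n" by simp
        have n: "odd n" "squarefree n" "1 < n" using assms(2)[OF \<open>n \<in> S\<close>] by auto
        let ?p = "smallest_prime_factor n"
        have p: "0 < ?p" using smallest_prime_factor(1)[OF n(3)] prime_gt_0_nat by blast
        show "w < a n"
        \<comment> \<open>Any cut-off exponent strictly between 1/4 and 1/3 would do: above 1/4 the
          error \<open>M * W^2 / n^2\<close> vanishes, below 1/3 the quantity \<open>n / p^3\<close>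
          tends to infinity in the other case.\<close>
        proof (cases "real n powr 0.33 \<le> real ?p")
          case True
          define W' where "W' = real (noncoprime_count n)"
          have W': "0 \<le> W'" "W' \<le> W n"
            using noncoprime_count_powr_le[OF n(3) True] by (auto simp: W'_def W_def)
          have M: "0 \<le> M n" using n(3) by (simp add: M_def)
          have b0: "0 \<le> b n" unfolding b_def by (rule inverse_merit_factor_nonneg[OF n(3)])
          have "(4 * M n ^ 3 * sqrt W' + 4 * M n * W'\<^sup>2) / (real n)\<^sup>2 \<le> \<epsilon> n"
            unfolding \<epsilon>_def using W' M
            by (intro divide_right_mono add_mono mult_left_mono power_mono) auto
          moreover have "(b n + 1) * (1 - \<delta> n) \<le> (b n + 1) * (1 - W' / real n)\<^sup>2"
          proof (rule mult_left_mono)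
            have "W' / real n \<le> W n / real n" using W' by (intro divide_right_mono) auto
            then have "1 - \<delta> n \<le> 1 - 2 * (W' / real n)" by (simp add: \<delta>_def)
            also have "\<dots> \<le> (1 - W' / real n)\<^sup>2" by (simp add: power2_diff)
            finally show "1 - \<delta> n \<le> (1 - W' / real n)\<^sup>2" .
          qed (use b0 in simp)
          moreover have "(b n + 1) * (1 - W' / real n)\<^sup>2 + c n - 1
              - (4 * M n ^ 3 * sqrt W' + 4 * M n * W'\<^sup>2) / (real n)\<^sup>2 \<le> a n"
            unfolding a_def b_def c_def M_def W'_def by (rule inverse_merit_factor_sum_ge_perturbed[OF n])
          \<comment> \<open>Shrinking \<open>c n\<close> as well lets the common factor
            \<open>1 - \<delta> n\<close>, positive by the choice of \<open>n\<close>, be taken out,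
            so that the bound on \<open>b n + c n\<close> applies whatever the sign of
            \<open>x + 1\<close>.\<close>
          moreover have "c n * (1 - \<delta> n) \<le> c n"
          proof -
            have "0 \<le> \<delta> n" using W' by (simp add: \<delta>_def)
            then show ?thesis by (intro mult_left_le) (auto simp: c_def)
          qed
          moreover have "(x + 1) * (1 - \<delta> n) \<le> (b n + c n + 1) * (1 - \<delta> n)"
            using xbc elim(3) by (intro mult_right_mono) auto
          moreover have "(b n + c n + 1) * (1 - \<delta> n) = (b n + 1) * (1 - \<delta> n) + c n * (1 - \<delta> n)"
            by (simp add: algebra_simps)
          ultimately show ?thesis using elim(2) by linarith
        next
          case False
          then have "real ?p ^ 3 \<le> (real n powr 0.33) ^ 3" by (intro power_mono) auto
          also have "\<dots> = real n powr 0.99" by (simp add: powr_powr flip: powr_numeral)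
          finally have "real n / (2 * real n powr 0.99) \<le> c n"
            unfolding c_def using p n(3) by (intro divide_left_mono mult_left_mono mult_pos_pos) auto
          moreover have "real n / (2 * real n powr 0.99) = real n powr 0.01 / 2"
            using powr_diff[of "real n" 1 "0.99"] n(3) by simp
          moreover have "c n - 1 \<le> a n"
            unfolding a_def c_def by (rule inverse_merit_factor_sum_ge[OF n(3)])
          ultimately show ?thesis using elim(4) by simp
        qed
      qed
    qed
    then show "\<forall>\<^sub>F n in F. y < ereal (a n)"
      by eventually_elim (use w(1) in \<open>meson less_ereal.simps(1) less_trans\<close>)
  qed
  finally show ?thesis by (simp add: F_def a_def b_def c_def)
qed

end
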